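(* If the polynomial $P_n^{\mathcal{B}}(x_{ij},y_{ij},z_i)$ is a reduced form of $m^{\mathcal{B}}[T^l]$ for a well-structured and well-labeled (i.e. good) graph $T^l$ on the vertex set $[n]$, then up to commutations $$P_n^{\mathcal{B}}(x_{ij},y_{ij},z_i)=\sum_G m^{\mathcal{B}}[G],$$ where the sum runs over all alternating well-structured spanning graphs $G$ of $\overline{T^l}$ on the vertex set $[n]$ with lexicographic edge-labels.
   Context: Signed graphs: a signed graph on $[n]=\{1,\dots,n\}$ is a finite multigraph (loops allowed) with each edge labeled $+$ or $-$; all loops are labeled $+$. An edge with endpoints $i,j$ and sign $\epsilon$ is written $(i,j,\epsilon)=(j,i,\epsilon)$. A positive edge is incident with a positive sign to both endpoints; a negative edge is incident with a positive sign to its smaller endpoint and with a negative sign to its larger one. A graph is alternating if at every vertex all incident edges are incident with the same sign. In an edge-labeled graph with $p$ edges the edges are labeled bijectively by $1,\dots,p$, and $(i,j,\epsilon)_a$ denotes the edge with label $a$. A graph $H$ on $[n]$ is well-structured if: (i) $H$ is noncrossing, i.e. there are no $i<j<k<l$ with edges $(i,k,\epsilon_1),(j,l,\epsilon_2)$ of $H$; (ii) for any edges $(i,j,+),(k,l,+)$ with $i<j$, $k<l$: $i<l$ and $k<j$; (iii) for any edges $(i,i,+),(k,l,+)$ with $k<l$: $k\le i\le l$; (iv) there are no edges $(i,i,+),(k,j,-)$ with $k<i<j$; (v) there are no edges $(i,j,+),(k,l,-)$ with $k\le i<j\le l$; (vi) $H$ is connected, contains exactly one loop, and contains no nonloop cycles.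 An edge-labeled graph $H$ is well-labeled if, for all signs $\epsilon_1,\epsilon_2$: (i) $(i,j,\epsilon_1)_a,(j,k,\epsilon_2)_b\in H$, $i<j<k$, imply $a<b$; (ii) $(i,j,\epsilon_1)_a,(i,k,\epsilon_2)_b\in H$, $i<j<k$, imply $a>b$; (iii) $(i,j,\epsilon_1)_a,(k,j,\epsilon_2)_b\in H$, $i<k<j$, imply $a>b$; (iv) $(i,i,+)_a,(i,j,-)_b\in H$, $i<j$, imply $a<b$; (v) $(j,j,+)_a,(i,j,-)_b\in H$, $i<j$, imply $a>b$; (vi) $(i,i,+)_a,(i,j,+)_b\in H$, $i<j$, imply $a>b$; (vii) $(j,j,+)_a,(i,j,+)_b\in H$, $i<j$, imply $a<b$. Transitive closure: let $e_1,\dots,e_n$ be the standard basis of $\mathbb{R}^n$; for $i\le j$ put $\mathrm{v}(i,j,-)=e_i-e_j$ (here $i<j$), $\mathrm{v}(i,j,+)=e_i+e_j$; $\mathcal{C}(G)$ is the set of nonnegative combinations of $\mathrm{v}(e)$, $e\in E(G)$. $\overline{G}$ is the graph on $[n]$ whose edges are all $(i,j,\epsilon)$ (including positive loops $(i,i,+)$) with $\mathrm{v}(i,j,\epsilon)\in\mathcal{C}(G)$. A spanning graph of $\overline{T^l}$ is a graph on $[n]$ all of whose edges are in $\overline{T^l}$. Lexicographic order on edges (each written with first index $\le$ second index): any positive edge is less than any negative edge; among edges of the same sign, $(i_1,j_1,\epsilon)$ is less than $(i_2,j_2,\epsilon)$ if $j_1>j_2$, or $j_1=j_2$ and $i_1>i_2$.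 Edge-labels are lexicographic if lexicographically smaller edges have smaller labels. For an edge-labeled graph $G$ with edges labeled $1,\dots,p$, $m^{\mathcal{B}}[G]=\mathrm{w}_1\cdots\mathrm{w}_p$ is the noncommutative monomial in which $\mathrm{w}_a$ is $x_{ij}$, $y_{ij}$ or $z_i$ according as the edge labeled $a$ is $(i,j,-)$, $(i,j,+)$ with $i<j$, or $(i,i,+)$. Reduced forms: work with noncommutative polynomials over $\mathbb{Q}$ in $x_{ij},y_{ij}$ $(1\le i<j\le n)$, $z_k$ $(k\in[n])$, modulo the commutations saying that two variables with disjoint index sets commute ("up to commutations" means equality modulo these). Reduction rules (applied to two adjacent letters of a monomial, possibly after commutations; for $i<j<k$ in (5)–(8'), $i<j$ in (9),(9')): (5) $x_{ij}x_{jk}\to x_{ik}x_{ij}+x_{jk}x_{ik}$; (5') $x_{jk}x_{ij}\to x_{ij}x_{ik}+x_{ik}x_{jk}$; (6) $x_{ij}y_{jk}\to y_{ik}x_{ij}+y_{jk}y_{ik}$; (6') $y_{jk}x_{ij}\to x_{ij}y_{ik}+y_{ik}y_{jk}$; (7) $x_{ik}y_{jk}\to y_{jk}y_{ij}+y_{ij}x_{ik}$; (7') $y_{jk}x_{ik}\to y_{ij}y_{jk}+x_{ik}y_{ij}$; (8) $y_{ik}x_{jk}\to x_{jk}y_{ij}+y_{ij}y_{ik}$; (8') $x_{jk}y_{ik}\to y_{ij}x_{jk}+y_{ik}y_{ij}$; (9) $x_{ij}z_j\to z_ix_{ij}+y_{ij}z_i+z_jy_{ij}$; (9') $z_jx_{ij}\to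 x_{ij}z_i+z_iy_{ij}+y_{ij}z_j$. A reduced form of a monomial is a polynomial obtained from it by successively applying these rules to monomials of the current polynomial, in any order, until no rule can be applied (even after commutations). *)

theory Defs
  imports Complex_Main "HOL-Library.Poly_Mapping"
begin

datatype sign = Pos | Neg

text \<open>
  The edge with endpoints \<open>i\<close>, \<open>j\<close> is stored in the normal form \<open>i \<le> j\<close>, which identifies
  \<open>(i, j, \<epsilon>)\<close> with \<open>(j, i, \<epsilon>)\<close>.
\<close>

type_synonym edge = "nat \<times> nat \<times> sign"

definition signed_edges :: "nat \<Rightarrow> edge set" where
  "signed_edges n =
     {(i, j, s). 1 \<le> i \<and> i \<le> j \<and> j \<le> n \<and> (s = Neg \<longrightarrow> i < j)}"

text \<open>
  An edge-labeled multigraph with \<open>p\<close> edges is the list of its edges in the order of their labels: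
  the edge labeled \<open>a\<close> is at the (zero-based) position \<open>a - 1\<close>, so comparing labels is comparing
  positions.  Parallel edges are distinct positions carrying the same entry.  Notions that concern
  unlabeled graphs are stated for such lists too; they do not depend on the order of the list.
\<close>

type_synonym lgraph = "edge list"

definition signed_graph :: "nat \<Rightarrow> lgraph \<Rightarrow> bool" where
  "signed_graph n G \<longleftrightarrow> set G \<subseteq> signed_edges n"

fun endpoints :: "edge \<Rightarrow> nat set" where
  "endpoints (i, j, s) = {i, j}"

fun is_loop :: "edge \<Rightarrow> bool" where
  "is_loop (i, j, s) \<longleftrightarrow> i = j"

text \<open>Meaningful only for the endpoints \<open>v\<close> of the edge.\<close>

fun incidence_sign :: "edge \<Rightarrow> nat \<Rightarrow> sign" where
  "incidence_sign (i, j, Pos) v = Pos"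
| "incidence_sign (i, j, Neg) v = (if v = i then Pos else Neg)"

definition alternating :: "nat \<Rightarrow> lgraph \<Rightarrow> bool" where
  "alternating n G \<longleftrightarrow>
     (\<forall>v\<in>{1..n}. \<forall>e\<in>set G. \<forall>f\<in>set G.
        v \<in> endpoints e \<and> v \<in> endpoints f \<longrightarrow> incidence_sign e v = incidence_sign f v)"

definition connected_graph :: "nat \<Rightarrow> lgraph \<Rightarrow> bool" where
  "connected_graph n G \<longleftrightarrow>
     (\<forall>u\<in>{1..n}. \<forall>v\<in>{1..n}. (u, v) \<in> {(a, b). \<exists>e\<in>set G. endpoints e = {a, b}}\<^sup>*)"

text \<open>
  A nonloop cycle: at least two distinct vertices \<open>vs\<close>, cyclically joined by edges at distinct
  positions \<open>ks\<close>.  Two parallel edges form a cycle of length 2.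
\<close>

definition has_nonloop_cycle :: "lgraph \<Rightarrow> bool" where
  "has_nonloop_cycle G \<longleftrightarrow>
     (\<exists>vs ks. 2 \<le> length vs \<and> distinct vs \<and>
        length ks = length vs \<and> distinct ks \<and> set ks \<subseteq> {..<length G} \<and>
        (\<forall>m<length vs. endpoints (G ! (ks ! m)) = {vs ! m, vs ! (Suc m mod length vs)}))"

definition well_structured :: "nat \<Rightarrow> lgraph \<Rightarrow> bool" where
  "well_structured n H \<longleftrightarrow>
     \<not> (\<exists>i j k l s t. i < j \<and> j < k \<and> k < l \<and> (i, k, s) \<in> set H \<and> (j, l, t) \<in> set H) \<and>
     (\<forall>i j k l. (i, j, Pos) \<in> set H \<and> (k, l, Pos) \<in> set H \<and> i < j \<and> k < l \<longrightarrow> i < l \<and> k < j) \<and>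
     (\<forall>i k l. (i, i, Pos) \<in> set H \<and> (k, l, Pos) \<in> set H \<and> k < l \<longrightarrow> k \<le> i \<and> i \<le> l) \<and>
     \<not> (\<exists>i j k. (i, i, Pos) \<in> set H \<and> (k, j, Neg) \<in> set H \<and> k < i \<and> i < j) \<and>
     \<not> (\<exists>i j k l. (i, j, Pos) \<in> set H \<and> (k, l, Neg) \<in> set H \<and> k \<le> i \<and> i < j \<and> j \<le> l) \<and>
     connected_graph n H \<and>
     length (filter is_loop H) = 1 \<and>
     \<not> has_nonloop_cycle H"

definition labeled_edge :: "lgraph \<Rightarrow> edge \<Rightarrow> nat \<Rightarrow> bool" where
  "labeled_edge H e a \<longleftrightarrow> 1 \<le> a \<and> a \<le> length H \<and> H ! (a - 1) = e"

definition well_labeled :: "lgraph \<Rightarrow> bool" where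
  "well_labeled H \<longleftrightarrow>
     (\<forall>i j k s t a b. labeled_edge H (i, j, s) a \<and> labeled_edge H (j, k, t) b \<and> i < j \<and> j < k
        \<longrightarrow> a < b) \<and>
     (\<forall>i j k s t a b. labeled_edge H (i, j, s) a \<and> labeled_edge H (i, k, t) b \<and> i < j \<and> j < k
        \<longrightarrow> a > b) \<and>
     (\<forall>i j k s t a b. labeled_edge H (i, j, s) a \<and> labeled_edge H (k, j, t) b \<and> i < k \<and> k < j
        \<longrightarrow> a > b) \<and>
     (\<forall>i j a b. labeled_edge H (i, i, Pos) a \<and> labeled_edge H (i, j, Neg) b \<and> i < j
        \<longrightarrow> a < b) \<and>
     (\<forall>i j a b. labeled_edge H (j, j, Pos) a \<and> labeled_edge H (i, j, Neg) b \<and> i < j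
        \<longrightarrow> a > b) \<and>
     (\<forall>i j a b. labeled_edge H (i, i, Pos) a \<and> labeled_edge H (i, j, Pos) b \<and> i < j
        \<longrightarrow> a > b) \<and>
     (\<forall>i j a b. labeled_edge H (j, j, Pos) a \<and> labeled_edge H (i, j, Pos) b \<and> i < j
        \<longrightarrow> a < b)"

text \<open>
  Vectors of \<open>\<real>\<^sup>n\<close> are functions \<open>nat \<Rightarrow> real\<close>; all those occurring below vanish outside \<open>{1..n}\<close>.
\<close>

definition unit_vec :: "nat \<Rightarrow> nat \<Rightarrow> real" where
  "unit_vec i = (\<lambda>k. if k = i then 1 else 0)"

fun edge_vec :: "edge \<Rightarrow> nat \<Rightarrow> real" where
  "edge_vec (i, j, Neg) = (\<lambda>k. unit_vec i k - unit_vec j k)"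
| "edge_vec (i, j, Pos) = (\<lambda>k. unit_vec i k + unit_vec j k)"

definition edge_cone :: "lgraph \<Rightarrow> (nat \<Rightarrow> real) set" where
  "edge_cone G = {(\<lambda>k. \<Sum>e\<in>set G. c e * edge_vec e k) | c. \<forall>e\<in>set G. 0 \<le> c e}"

definition trans_closure :: "nat \<Rightarrow> lgraph \<Rightarrow> edge set" where
  "trans_closure n G = {e \<in> signed_edges n. edge_vec e \<in> edge_cone G}"

definition spanning_graph_of_closure :: "nat \<Rightarrow> lgraph \<Rightarrow> lgraph \<Rightarrow> bool" where
  "spanning_graph_of_closure n T G \<longleftrightarrow> signed_graph n G \<and> set G \<subseteq> trans_closure n T"

fun edge_less :: "edge \<Rightarrow> edge \<Rightarrow> bool" where
  "edge_less (i1, j1, s1) (i2, j2, s2) \<longleftrightarrow>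
     s1 = Pos \<and> s2 = Neg \<or> s1 = s2 \<and> (j1 > j2 \<or> j1 = j2 \<and> i1 > i2)"

definition lexicographic_labels :: "lgraph \<Rightarrow> bool" where
  "lexicographic_labels G \<longleftrightarrow>
     (\<forall>e f a b. labeled_edge G e a \<and> labeled_edge G f b \<and> edge_less e f \<longrightarrow> a < b)"

datatype letter = X nat nat | Y nat nat | Z nat

fun indices :: "letter \<Rightarrow> nat set" where
  "indices (X i j) = {i, j}"
| "indices (Y i j) = {i, j}"
| "indices (Z i) = {i}"

type_synonym ncpoly = "letter list \<Rightarrow>\<^sub>0 rat"

fun edge_letter :: "edge \<Rightarrow> letter" where
  "edge_letter (i, j, Neg) = X i j"
| "edge_letter (i, j, Pos) = (if i = j then Z i else Y i j)"

definition graph_monomial :: "lgraph \<Rightarrow> letter list" where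
  "graph_monomial G = map edge_letter G"

inductive comm_swap :: "letter list \<Rightarrow> letter list \<Rightarrow> bool" where
  "indices a \<inter> indices b = {} \<Longrightarrow> comm_swap (u @ [a, b] @ v) (u @ [b, a] @ v)"

definition comm_equiv :: "letter list \<Rightarrow> letter list \<Rightarrow> bool" where
  "comm_equiv = comm_swap\<^sup>*\<^sup>*"

text \<open>
  The two-sided ideal of the free algebra generated by the commutators \<open>ab - ba\<close> of letters with
  disjoint index sets; it is the linear span of the elements \<open>u (ab - ba) v\<close> for words \<open>u\<close>, \<open>v\<close>.
\<close>

inductive_set comm_ideal :: "ncpoly set" where
  comm_ideal_zero: "0 \<in> comm_ideal"
| comm_ideal_add:
    "p \<in> comm_ideal \<Longrightarrow> indices a \<inter> indices b = {} \<Longrightarrow>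
       p + (Poly_Mapping.single (u @ [a, b] @ v) c - Poly_Mapping.single (u @ [b, a] @ v) c)
         \<in> comm_ideal"

definition eq_up_to_commutations :: "ncpoly \<Rightarrow> ncpoly \<Rightarrow> bool" where
  "eq_up_to_commutations p q \<longleftrightarrow> p - q \<in> comm_ideal"

text \<open>\<open>reduction_rule a b rs\<close>: the product \<open>ab\<close> may be replaced by the sum of the words in \<open>rs\<close>.\<close>

inductive reduction_rule :: "letter \<Rightarrow> letter \<Rightarrow> letter list list \<Rightarrow> bool" where
  xx_rule: "i < j \<Longrightarrow> j < k \<Longrightarrow>
    reduction_rule (X i j) (X j k) [[X i k, X i j], [X j k, X i k]]"
| xx_rule': "i < j \<Longrightarrow> j < k \<Longrightarrow>
    reduction_rule (X j k) (X i j) [[X i j, X i k], [X i k, X j k]]"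
| xy_rule: "i < j \<Longrightarrow> j < k \<Longrightarrow>
    reduction_rule (X i j) (Y j k) [[Y i k, X i j], [Y j k, Y i k]]"
| xy_rule': "i < j \<Longrightarrow> j < k \<Longrightarrow>
    reduction_rule (Y j k) (X i j) [[X i j, Y i k], [Y i k, Y j k]]"
| x_y_rule: "i < j \<Longrightarrow> j < k \<Longrightarrow>
    reduction_rule (X i k) (Y j k) [[Y j k, Y i j], [Y i j, X i k]]"
| x_y_rule': "i < j \<Longrightarrow> j < k \<Longrightarrow>
    reduction_rule (Y j k) (X i k) [[Y i j, Y j k], [X i k, Y i j]]"
| yx_rule: "i < j \<Longrightarrow> j < k \<Longrightarrow>
    reduction_rule (Y i k) (X j k) [[X j k, Y i j], [Y i j, Y i k]]"
| yx_rule': "i < j \<Longrightarrow> j < k \<Longrightarrow>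
    reduction_rule (X j k) (Y i k) [[Y i j, X j k], [Y i k, Y i j]]"
| xz_rule: "i < j \<Longrightarrow>
    reduction_rule (X i j) (Z j) [[Z i, X i j], [Y i j, Z i], [Z j, Y i j]]"
| xz_rule': "i < j \<Longrightarrow>
    reduction_rule (Z j) (X i j) [[X i j, Z i], [Z i, Y i j], [Y i j, Z j]]"

text \<open>
  One step rewrites a monomial \<open>w\<close> occurring in \<open>p\<close>, together with its coefficient; commutations
  may be applied to \<open>w\<close> first.  Commuting only inside a monomial, rather than passing to another
  representative of \<open>p\<close> modulo \<open>comm_ideal\<close>, prevents cancelling pairs of terms from being
  introduced and then reduced in different ways.
\<close>

inductive reduction_step :: "ncpoly \<Rightarrow> ncpoly \<Rightarrow> bool" where
  "w \<in> Poly_Mapping.keys p \<Longrightarrow> comm_equiv w (u @ [a, b] @ v) \<Longrightarrow> reduction_rule a b rs \<Longrightarrow>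
     reduction_step p
       (p - Poly_Mapping.single w (Poly_Mapping.lookup p w)
          + (\<Sum>r\<leftarrow>rs. Poly_Mapping.single (u @ r @ v) (Poly_Mapping.lookup p w)))"

definition reduced_form :: "letter list \<Rightarrow> ncpoly \<Rightarrow> bool" where
  "reduced_form w P \<longleftrightarrow>
     reduction_step\<^sup>*\<^sup>* (Poly_Mapping.single w 1) P \<and> (\<nexists>Q. reduction_step P Q)"

end

theory Submission
  imports Defs "HOL-Library.Product_Lexorder"
begin

text \<open>
  A reduction replaces two edges \<open>e\<close>, \<open>f\<close> of a good graph by two of \<open>e\<close>, \<open>f\<close>, \<open>g\<close> (with a third
  case for loops), where the vector of \<open>g\<close> is the sum of those of \<open>e\<close> and \<open>f\<close>.  The new graphs are
  again good, their cones cover the old cone, and a graph spanning \<open>\<real>\<^sup>n\<close> cannot lie in two of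
  these cones, because a linear functional separates them.  An irreducible good graph is
  alternating: a nonalternating pair at minimal distance can be made adjacent by commutations,
  since a tree has no other connection between the two edges.  Finally a vector determines the
  alternating graph in whose cone it lies, together with its coefficients.  So if \<open>G\<close> lies in the
  closure of \<open>T\<close>, the sum of the edge vectors of \<open>G\<close> lies in the cone of a leaf of the reduction
  tree, and this leaf is \<open>G\<close>.
\<close>

text \<open>Fix a graph \<open>A\<close> of the sum and count, with coefficients, the words of the
  current polynomial whose closure contains all edges of \<open>A\<close>. At the start this number
  is 1. At the end it is the sum of the coefficients of the words equivalent to that of
  \<open>A\<close>, because the only admissible graph in the closure of an alternating one is that
  graph itself. So everything rests on the count being unchanged by a step. The obstacle: the cones
  of the reducts cover the old cone point by point, while \<open>A\<close> needs all its edges in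
  one and the same cone. A point inside the cone of \<open>A\<close> selects a reduct, but that the
  edges follow the point is known only once it has been traced down to an irreducible graph. Hence
  the invariance presupposes that the reductions below the step end, and it is proved backwards,
  from the irreducible polynomial, whereas goodness is carried forwards. The coefficients stay
  nonnegative, so that no reduct, and with it no information about termination, is lost by
  cancellation.\<close>

section \<open>Pairs of edges and the local form of the reduction rules\<close>

text \<open>The disjuncts are the violations of the conditions (i) to (v) of a well-structured graph.\<close>

fun conflict :: "edge \<Rightarrow> edge \<Rightarrow> bool" where
  "conflict (i, k, s) (j, l, t) \<longleftrightarrow>
     i < j \<and> j < k \<and> k < l \<or>
     s = Pos \<and> t = Pos \<and> i < k \<and> j < l \<and> \<not> (i < l \<and> j < k) \<or>
     s = Pos \<and> t = Pos \<and> i = k \<and> j < l \<and> \<not> (j \<le> i \<and> i \<le> l) \<or>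
     s = Pos \<and> t = Neg \<and> i = k \<and> j < i \<and> i < l \<or>
     s = Pos \<and> t = Neg \<and> i < k \<and> j \<le> i \<and> k \<le> l"

text \<open>
  The well-labeling conditions (i) to (vii), read as: the label of the first edge must be the
  smaller one.
\<close>

fun prec :: "edge \<Rightarrow> edge \<Rightarrow> bool" where
  "prec (i, j, s) (k, l, t) \<longleftrightarrow>
     i < j \<and> j = k \<and> k < l \<or> i = k \<and> k < l \<and> l < j \<or> j = l \<and> k < i \<and> i < j \<or>
     i = j \<and> k = i \<and> i < l \<and> s = Pos \<and> t = Neg \<or>
     k = l \<and> j = k \<and> i < j \<and> s = Neg \<and> t = Pos \<or>
     k = l \<and> i = k \<and> i < j \<and> s = Pos \<and> t = Pos \<or>
     i = j \<and> l = i \<and> k < l \<and> s = Pos \<and> t = Pos"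

text \<open>
  The rules (5)/(6), (7')/(8') and (9); the order of the letters in the other rules contradicts
  well-labeling.
\<close>

inductive edge_rule :: "edge \<Rightarrow> edge \<Rightarrow> (edge \<times> edge) list \<Rightarrow> bool" where
  chain_rule: "i < j \<Longrightarrow> j < k \<Longrightarrow> edge_rule (i, j, Neg) (j, k, s)
     [((i, k, s), (i, j, Neg)), ((j, k, s), (i, k, s))]"
| fork_rule: "i < j \<Longrightarrow> j < k \<Longrightarrow> s \<noteq> t \<Longrightarrow> edge_rule (j, k, s) (i, k, t)
     [((i, j, Pos), (j, k, s)), ((i, k, t), (i, j, Pos))]"
| loop_rule: "i < j \<Longrightarrow> edge_rule (i, j, Neg) (j, j, Pos)
     [((i, i, Pos), (i, j, Neg)), ((i, j, Pos), (i, i, Pos)), ((j, j, Pos), (i, j, Pos))]"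

definition clash :: "edge \<Rightarrow> edge \<Rightarrow> bool" where
  "clash x y \<longleftrightarrow> conflict x y \<or> conflict y x"



















text \<open>The assumption \<open>\<not> clash e f\<close> excludes the fork with
  \<open>s = Pos\<close> and \<open>t = Neg\<close>, a violation of condition (v). One of its
  reducts would consist of positive edges (i, j), (j, k) with i < j < k, against condition
  (ii).\<close>

lemma edge_rule_self:
  assumes "edge_rule e f rs" "(e', f') \<in> set rs" "\<not> clash e f"
  shows "\<not> clash e' f' \<and> \<not> clash e' e' \<and> \<not> clash f' f' \<and> \<not> prec f' e'"
  using assms(1)
proof (cases rule: edge_rule.cases)
  case (chain_rule i j k t)
  then show ?thesis using assms(2,3) by (cases t; simp add: clash_def; elim disjE conjE; simp)
next
  case (fork_rule i j k t t')
  then show ?thesis using assms(2,3) by (cases t; cases t'; simp add: clash_def; elim disjE conjE; simp)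
next
  case (loop_rule i j)
  then show ?thesis using assms(2,3) by (simp add: clash_def; elim disjE conjE; simp)
qed

lemma nat_eq_iff_real_le: "m = n \<longleftrightarrow> real m \<le> real n \<and> real n \<le> real m"
  by auto

text \<open>The prover \<open>argo\<close> knows the order of the reals but not that of the naturals.\<close>

lemmas order_real_simps =
  sign.simps simp_thms Un_insert_left Un_insert_right insert_subset empty_subsetI insert_iff
  empty_iff Un_empty_left Un_iff of_nat_less_iff[where 'a = real, symmetric]
  of_nat_le_iff[where 'a = real, symmetric] nat_eq_iff_real_le

text \<open>Here \<open>x\<close> has a smaller label than the pair. Edges of a reduct that are
  already \<open>e\<close> or \<open>f\<close> need no check, and for the new ones the claim
  concerns only signs and the order of at most five vertices. The side conditions exclude an
  \<open>x\<close> that joins two vertices of the triangle or is a second loop; a tree with one loop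
  has no such edge.\<close>

lemma edge_rule_left:
  assumes "edge_rule e f rs" "(e', f') \<in> set rs" "\<not> clash x e" "\<not> clash x f"
    and "x = (p, q, s)" "p \<le> q" "s = Neg \<longrightarrow> p < q"
    and "\<not> (p < q \<and> {p, q} \<subseteq> endpoints e \<union> endpoints f)"
    and "is_loop f \<longrightarrow> p < q"
    and "\<not> prec e x \<and> \<not> prec f x"
  shows "\<not> clash x e' \<and> \<not> clash x f' \<and> \<not> prec e' x \<and> \<not> prec f' x"
  using assms(1)
proof (cases rule: edge_rule.cases)
  case (chain_rule i j k t)
  \<comment> \<open>Naming the casts turns the goal into one about the order of real
    variables.\<close>
  obtain I J K P Q where R: "real i = I" "real j = J" "real k = K" "real p = P" "real q = Q" by blast
  note a = assms(3-)[unfolded chain_rule clash_def assms(5) conflict.simps prec.simps endpoints.simps is_loop.simps]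
  have "\<not> clash x (i, k, t) \<and> \<not> prec (i, k, t) x"
    unfolding clash_def assms(5) conflict.simps prec.simps 
    by (insert a chain_rule(4,5) assms(6), cases s; cases t; simp only: order_real_simps R; thin_tac "s = _", thin_tac "t = _"; argo)
  then show ?thesis using assms(2-4,10) chain_rule by auto
next
  case (fork_rule i j k t t')
  obtain I J K P Q where R: "real i = I" "real j = J" "real k = K" "real p = P" "real q = Q" by blast
  note a = assms(3-)[unfolded fork_rule clash_def assms(5) conflict.simps prec.simps endpoints.simps is_loop.simps]
  have "\<not> clash x (i, j, Pos) \<and> \<not> prec (i, j, Pos) x"
    unfolding clash_def assms(5) conflict.simps prec.simps 
    by (insert a fork_rule(4-6) assms(6), cases s; cases t; cases t'; simp only: order_real_simps R; thin_tac "s = _", thin_tac "t = _", thin_tac "t' = _"; argo)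
  then show ?thesis using assms(2-4,10) fork_rule by auto
next
  case (loop_rule i j)
  obtain I J P Q where R: "real i = I" "real j = J" "real p = P" "real q = Q" by blast
  note a = assms(3-)[unfolded loop_rule clash_def assms(5) conflict.simps prec.simps endpoints.simps is_loop.simps]
  have "\<not> clash x (i, j, Pos) \<and> \<not> prec (i, j, Pos) x"
    "\<not> clash x (i, i, Pos) \<and> \<not> prec (i, i, Pos) x"
    unfolding clash_def assms(5) conflict.simps prec.simps 
    by (insert a loop_rule(4) assms(6), cases s; simp only: order_real_simps R; thin_tac "s = _"; argo)+
  then show ?thesis using assms(2-4,10) loop_rule by auto
qed

text \<open>The mirror case: \<open>x\<close> has a larger label than the pair.\<close>

lemma edge_rule_right:
  assumes "edge_rule e f rs" "(e', f') \<in> set rs" "\<not> clash x e" "\<not> clash x f"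
    and "x = (p, q, s)" "p \<le> q" "s = Neg \<longrightarrow> p < q"
    and "\<not> (p < q \<and> {p, q} \<subseteq> endpoints e \<union> endpoints f)"
    and "is_loop f \<longrightarrow> p < q"
    and "\<not> prec x e \<and> \<not> prec x f"
  shows "\<not> clash x e' \<and> \<not> clash x f' \<and> \<not> prec x e' \<and> \<not> prec x f'"
  using assms(1)
proof (cases rule: edge_rule.cases)
  case (chain_rule i j k t)
  obtain I J K P Q where R: "real i = I" "real j = J" "real k = K" "real p = P" "real q = Q" by blast
  note a = assms(3-)[unfolded chain_rule clash_def assms(5) conflict.simps prec.simps endpoints.simps is_loop.simps]
  have "\<not> clash x (i, k, t) \<and> \<not> prec x (i, k, t)"
    unfolding clash_def assms(5) conflict.simps prec.simps 
    by (insert a chain_rule(4,5) assms(6), cases s; cases t; simp only: order_real_simps R; thin_tac "s = _", thin_tac "t = _"; argo)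
  then show ?thesis using assms(2-4,10) chain_rule by auto
next
  case (fork_rule i j k t t')
  obtain I J K P Q where R: "real i = I" "real j = J" "real k = K" "real p = P" "real q = Q" by blast
  note a = assms(3-)[unfolded fork_rule clash_def assms(5) conflict.simps prec.simps endpoints.simps is_loop.simps]
  have "\<not> clash x (i, j, Pos) \<and> \<not> prec x (i, j, Pos)"
    unfolding clash_def assms(5) conflict.simps prec.simps 
    by (insert a fork_rule(4-6) assms(6), cases s; cases t; cases t'; simp only: order_real_simps R; thin_tac "s = _", thin_tac "t = _", thin_tac "t' = _"; argo)
  then show ?thesis using assms(2-4,10) fork_rule by auto
next
  case (loop_rule i j)
  obtain I J P Q where R: "real i = I" "real j = J" "real p = P" "real q = Q" by blast
  note a = assms(3-)[unfolded loop_rule clash_def assms(5) conflict.simps prec.simps endpoints.simps is_loop.simps]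
  have "\<not> clash x (i, j, Pos) \<and> \<not> prec x (i, j, Pos)"
    "\<not> clash x (i, i, Pos) \<and> \<not> prec x (i, i, Pos)"
    unfolding clash_def assms(5) conflict.simps prec.simps 
    by (insert a loop_rule(4) assms(6), cases s; simp only: order_real_simps R; thin_tac "s = _"; argo)+
  then show ?thesis using assms(2-4,10) loop_rule by auto
qed

section \<open>Connectedness and nonloop cycles\<close>

definition adj :: "lgraph \<Rightarrow> (nat \<times> nat) set" where
  "adj G = {(a, b). \<exists>e\<in>set G. endpoints e = {a, b}}"

lemma adj_Nil [simp]: "adj [] = {}"
  by (simp add: adj_def)

lemma adj_Cons: "adj ((a, b, s) # G) = insert (a, b) (insert (b, a) (adj G))"
  by (auto simp: adj_def doubleton_eq_iff)

lemma adj_sym: "(a, b) \<in> adj G \<longleftrightarrow> (b, a) \<in> adj G"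
  by (auto simp: adj_def insert_commute)

lemma adj_mono: "set G \<subseteq> set H \<Longrightarrow> adj G \<subseteq> adj H"
  by (auto simp: adj_def)

lemma connected_graph_adj:
  "connected_graph n G \<longleftrightarrow> (\<forall>u\<in>{1..n}. \<forall>v\<in>{1..n}. (u, v) \<in> (adj G)\<^sup>*)"
  by (simp add: connected_graph_def adj_def)

lemma adj_rtrancl_sym: "(a, b) \<in> (adj G)\<^sup>* \<Longrightarrow> (b, a) \<in> (adj G)\<^sup>*"
  by (metis adj_sym symI sym_rtrancl symD)

section \<open>Counting components and nonloop edges\<close>

definition nonloops :: "lgraph \<Rightarrow> nat" where
  "nonloops G = length (filter (\<lambda>e. \<not> is_loop e) G)"

text \<open>Acyclicity in a form made for induction over the list; explicit cycles are compared with
  it below.\<close>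

fun forest :: "lgraph \<Rightarrow> bool" where
  "forest [] = True"
| "forest ((a, b, s) # G) \<longleftrightarrow> forest G \<and> (a = b \<or> (a, b) \<notin> (adj G)\<^sup>*)"

text \<open>Induction over the edges: a nonloop edge lowers the number of components, which is the
  number of values of \<open>f\<close> on \<open>V\<close>, by one or not at all, and by one exactly
  when it satisfies its condition in \<open>forest\<close>. With a labelling, merging two components
  is a change of values.\<close>

lemma component_labelling:
  assumes "finite V" "\<And>e. e \<in> set G \<Longrightarrow> endpoints e \<subseteq> V"
  shows "\<exists>f :: nat \<Rightarrow> nat. (\<forall>u v. f u = f v \<longleftrightarrow> (u, v) \<in> (adj G)\<^sup>*) \<and>
    card V \<le> card (f ` V) + nonloops G \<and> (forest G \<longleftrightarrow> card V = card (f ` V) + nonloops G)"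
  using assms(2)
proof (induction G)
  case Nil
  show ?case by (rule exI[of _ id]) (auto simp: nonloops_def)
next
  case (Cons e G)
  obtain a b s where e: "e = (a, b, s)" by (cases e)
  from Cons obtain f :: "nat \<Rightarrow> nat" where f: "\<And>u v. f u = f v \<longleftrightarrow> (u, v) \<in> (adj G)\<^sup>*"
    "card V \<le> card (f ` V) + nonloops G" "forest G \<longleftrightarrow> card V = card (f ` V) + nonloops G"
    by auto
  have V: "a \<in> V" "b \<in> V" using Cons.prems[of e] e by auto
  show ?case
  proof (cases "f a = f b")
    case True
    have "(u, v) \<in> (adj (e # G))\<^sup>* \<longleftrightarrow> f u = f v" for u v
    proof
      assume "(u, v) \<in> (adj (e # G))\<^sup>*"
      then show "f u = f v"
      proof (induction rule: rtrancl_induct)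
        case (step y z)
        then have "(y, z) \<in> adj G \<or> {f y, f z} = {f a, f b}" unfolding e adj_Cons by auto
        then have "f y = f z"
        proof
          assume "(y, z) \<in> adj G"
          then show ?thesis using f(1) by blast
        next
          assume "{f y, f z} = {f a, f b}"
          then show ?thesis unfolding True by (simp add: set_eq_iff) metis
        qed
        then show ?case using step by simp
      qed simp
    next
      assume "f u = f v"
      then show "(u, v) \<in> (adj (e # G))\<^sup>*"
        using f(1) rtrancl_mono[OF adj_mono[of G "e # G"]] by auto
    qed
    moreover have "forest (e # G) \<longleftrightarrow> card V = card (f ` V) + nonloops (e # G)"
      using f True by (auto simp: e nonloops_def)
    ultimately show ?thesis using f(2) by (intro exI[of _ f]) (auto simp: nonloops_def)
  next
    case False
    define g where "g = (\<lambda>v. if f v = f a then f b else f v)"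
    have sub: "(adj G)\<^sup>* \<subseteq> (adj (e # G))\<^sup>*" by (intro rtrancl_mono adj_mono) auto
    have ab: "(a, b) \<in> (adj (e # G))\<^sup>*" "(b, a) \<in> (adj (e # G))\<^sup>*"
      unfolding e adj_Cons by auto
    have "(u, v) \<in> (adj (e # G))\<^sup>* \<longleftrightarrow> g u = g v" for u v
    proof
      assume "(u, v) \<in> (adj (e # G))\<^sup>*"
      then show "g u = g v"
      proof (induction rule: rtrancl_induct)
        case (step y z)
        then have "f y = f z \<or> {f y, f z} = {f a, f b}" using f(1) unfolding e adj_Cons by auto
        then have "g y = g z" unfolding g_def by (auto simp: doubleton_eq_iff)
        then show ?case using step by simp
      qed simp
    next
      assume "g u = g v"
      then consider "f u = f v" | "f u = f a" "f v = f b" | "f u = f b" "f v = f a"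
        unfolding g_def by (auto split: if_splits)
      then show "(u, v) \<in> (adj (e # G))\<^sup>*"
      proof cases
        case 1 then show ?thesis using f(1) sub by auto
      next
        case 2
        then have "(u, a) \<in> (adj (e # G))\<^sup>*" "(b, v) \<in> (adj (e # G))\<^sup>*" using f(1)[of u a] f(1)[of b v] sub by auto
        then show ?thesis using ab by (meson rtrancl_trans)
      next
        case 3
        then have "(u, b) \<in> (adj (e # G))\<^sup>*" "(a, v) \<in> (adj (e # G))\<^sup>*" using f(1)[of u b] f(1)[of a v] sub by auto
        then show ?thesis using ab by (meson rtrancl_trans)
      qed
    qed
    moreover have "g ` V = f ` V - {f a}"
      using V False by (auto simp: g_def image_iff)
    then have "card (f ` V) = Suc (card (g ` V))"
      using V assms(1) by (metis card_Suc_Diff1 finite_imageI image_eqI)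
    moreover have "a \<noteq> b" using False by auto
    ultimately show ?thesis using f False by (intro exI[of _ g]) (auto simp: nonloops_def e)
  qed
qed

section \<open>Explicit cycles and the removal of an edge\<close>

lemma rtrancl_distinct_path:
  assumes "(u, v) \<in> R\<^sup>*"
  shows "\<exists>vs. vs \<noteq> [] \<and> hd vs = u \<and> last vs = v \<and> distinct vs \<and> successively (\<lambda>x y. (x, y) \<in> R) vs"
  using assms
proof (induction rule: converse_rtrancl_induct)
  case base
  show ?case by (rule exI[of _ "[v]"]) simp
next
  case (step u w)
  then obtain vs where vs: "vs \<noteq> []" "hd vs = w" "last vs = v" "distinct vs"
    "successively (\<lambda>x y. (x, y) \<in> R) vs" by auto
  show ?case
  proof (cases "u \<in> set vs")
    case True
    \<comment> \<open>If the path already passes through \<open>u\<close>, its part before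
      \<open>u\<close> is cut off.\<close>
    then obtain xs ys where "vs = xs @ u # ys" by (meson split_list)
    then show ?thesis using vs by (intro exI[of _ "u # ys"]) (auto simp: successively_append_iff)
  next
    case False
    then show ?thesis using vs step by (intro exI[of _ "u # vs"]) (auto simp: successively_Cons)
  qed
qed

lemma has_nonloop_cycle_Cons: "has_nonloop_cycle G \<Longrightarrow> has_nonloop_cycle (e # G)"
proof -
  assume "has_nonloop_cycle G"
  then obtain vs ks where c: "2 \<le> length vs" "distinct vs" "length ks = length vs" "distinct ks"
    "set ks \<subseteq> {..<length G}"
    "\<And>m. m < length vs \<Longrightarrow> endpoints (G ! (ks ! m)) = {vs ! m, vs ! (Suc m mod length vs)}"
    unfolding has_nonloop_cycle_def by blast
  show ?thesis
    unfolding has_nonloop_cycle_def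
    by (rule exI[of _ vs], rule exI[of _ "map Suc ks"]) (use c in \<open>auto simp: distinct_map\<close>)
qed

lemma closing_edge_cycle:
  assumes "a \<noteq> b" "(a, b) \<in> (adj G)\<^sup>*"
  shows "has_nonloop_cycle ((a, b, s) # G)"
proof -
  obtain vs where vs: "vs \<noteq> []" "hd vs = a" "last vs = b" "distinct vs"
    "successively (\<lambda>x y. (x, y) \<in> adj G) vs" using rtrancl_distinct_path[OF assms(2)] by auto
  have len: "2 \<le> length vs"
  proof (rule ccontr)
    assume "\<not> 2 \<le> length vs"
    then obtain x where "vs = [x]" using vs(1) by (cases vs; cases "tl vs") auto
    then show False using vs(2,3) assms(1) by simp
  qed
  have "\<exists>k<length G. endpoints (G ! k) = {vs ! m, vs ! Suc m}" if "Suc m < length vs" for m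
  proof -
    have "(vs ! m, vs ! Suc m) \<in> adj G" using vs(5) that by (simp add: successively_conv_nth)
    then obtain e where e: "e \<in> set G" "endpoints e = {vs ! m, vs ! Suc m}" unfolding adj_def by blast
    then obtain k where "k < length G" "G ! k = e" unfolding in_set_conv_nth by blast
    then show ?thesis using e by blast
  qed
  then have "\<forall>m. \<exists>k. Suc m < length vs \<longrightarrow>
      k < length G \<and> endpoints (G ! k) = {vs ! m, vs ! Suc m}" by blast
  then obtain K where "\<forall>m. Suc m < length vs \<longrightarrow>
      K m < length G \<and> endpoints (G ! K m) = {vs ! m, vs ! Suc m}" by (rule choice[THEN exE])
  then have K: "\<And>m. Suc m < length vs \<Longrightarrow> K m < length G"
    "\<And>m. Suc m < length vs \<Longrightarrow> endpoints (G ! K m) = {vs ! m, vs ! Suc m}" by auto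
  \<comment> \<open>Position 0 is the new edge, used for the last step from \<open>b\<close> back to
    \<open>a\<close>; the positions of \<open>G\<close> shift by one.\<close>
  define ks where "ks = map (\<lambda>m. if Suc m = length vs then 0 else Suc (K m)) [0..<length vs]"
  \<comment> \<open>As the vertices are distinct, \<open>vs ! m\<close> is not an end of a later
    step, so the arbitrarily chosen positions differ.\<close>
  have inj: "K m \<noteq> K l" if "m < l" "Suc l < length vs" for m l
  proof
    assume "K m = K l"
    then have "{vs ! m, vs ! Suc m} = {vs ! l, vs ! Suc l}" using K(2)[of m] K(2)[of l] that by simp
    then have "vs ! m = vs ! l \<or> vs ! m = vs ! Suc l" unfolding doubleton_eq_iff by blast
    then show False using vs(4) that by (simp add: nth_eq_iff_index_eq)
  qed
  have lt: "ks ! m \<noteq> ks ! l" if "m < l" "l < length vs" for m l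
    using inj[OF that(1)] that by (auto simp: ks_def)
  have "ks ! m \<noteq> ks ! l" if "m < length vs" "l < length vs" "m \<noteq> l" for m l
    using lt[of m l] lt[of l m] that by linarith
  moreover have "length ks = length vs" by (simp add: ks_def)
  ultimately have "distinct ks" unfolding distinct_conv_nth by metis
  moreover have "endpoints (((a, b, s) # G) ! (ks ! m)) = {vs ! m, vs ! (Suc m mod length vs)}"
    if "m < length vs" for m
  proof (cases "Suc m = length vs")
    case True
    then have "m = length vs - 1" using that by simp
    then have "vs ! m = b" "vs ! 0 = a" using vs by (simp_all add: last_conv_nth hd_conv_nth)
    then show ?thesis using True that by (auto simp: ks_def)
  next
    case False
    then show ?thesis using that K(2)[of m] by (simp add: ks_def)
  qed
  moreover have "set ks \<subseteq> {..<length ((a, b, s) # G)}" using K(1) by (auto simp: ks_def)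
  moreover have "length ks = length vs" by (simp add: ks_def)
  ultimately have "2 \<le> length vs \<and> distinct vs \<and> length ks = length vs \<and> distinct ks \<and>
      set ks \<subseteq> {..<length ((a, b, s) # G)} \<and>
      (\<forall>m<length vs. endpoints (((a, b, s) # G) ! (ks ! m)) = {vs ! m, vs ! (Suc m mod length vs)})"
    using len vs(4) by simp
  then show ?thesis unfolding has_nonloop_cycle_def by (intro exI)
qed

lemma not_cycle_forest: "\<not> has_nonloop_cycle G \<Longrightarrow> forest G"
proof (induction G)
  case (Cons e G)
  then show ?case using has_nonloop_cycle_Cons[of G e] closing_edge_cycle[of "fst e" "fst (snd e)" G "snd (snd e)"]
    by (cases e) auto
qed simp

text \<open>Dropping the first edge of a cycle changes no component, since the other edges of the
  cycle join its ends.\<close>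

lemma cycle_removable_edge:
  assumes "has_nonloop_cycle G"
  obtains u e w where "G = u @ e # w" "\<not> is_loop e" "(adj (u @ w))\<^sup>* = (adj G)\<^sup>*"
proof -
  from assms obtain vs ks where c: "2 \<le> length vs" "distinct vs" "length ks = length vs" "distinct ks"
    "set ks \<subseteq> {..<length G}"
    "\<And>m. m < length vs \<Longrightarrow> endpoints (G ! (ks ! m)) = {vs ! m, vs ! (Suc m mod length vs)}"
    unfolding has_nonloop_cycle_def by blast
  define k where "k = ks ! 0"
  have "ks ! 0 \<in> set ks" using c(1,3) by (intro nth_mem) linarith
  then have k: "k < length G" using c(5) by (auto simp: k_def)
  define u w where "u = take k G" and "w = drop (Suc k) G"
  have G: "G = u @ G ! k # w" using k by (simp add: u_def w_def id_take_nth_drop)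
  have len: "length u = k" using k by (simp add: u_def)
  \<comment> \<open>Only the position \<open>k\<close> is removed: a parallel edge with the same
    entry survives in \<open>u @ w\<close>.\<close>
  have nth: "G ! j \<in> set (u @ w)" if "j < length G" "j \<noteq> k" for j
  proof -
    have "j < k \<and> G ! j = u ! j \<or> k < j \<and> G ! j = w ! (j - Suc k)"
    proof (cases "j < k")
      case False
      then obtain i where "j = Suc k + i" using \<open>j \<noteq> k\<close> le_Suc_ex[of "Suc k" j] by auto
      then show ?thesis using that k by (simp add: w_def)
    qed (simp add: u_def)
    moreover have "j - Suc k < length w" if "k < j" using that \<open>j < length G\<close> by (simp add: w_def)
    ultimately have "G ! j \<in> set u \<or> G ! j \<in> set w" using len nth_mem[of j u] nth_mem[of "j - Suc k" w] by metis
    then show ?thesis by simp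
  qed
  have "vs \<noteq> []" using c(1) by auto
  then have e0: "endpoints (G ! k) = {vs ! 0, vs ! 1}" using c(6)[of 0] c(1) by (simp add: k_def)
  have nbr: "(vs ! m, vs ! (Suc m mod length vs)) \<in> adj (u @ w)" if "0 < m" "m < length vs" for m
  proof -
    have "0 < length ks" "m < length ks" using that c(3) by auto
    then have "ks ! m \<noteq> k" using that(1) c(4) nth_eq_iff_index_eq[of ks m 0] by (simp add: k_def)
    moreover have "ks ! m \<in> set ks" using that c(3) by (intro nth_mem) simp
    then have "ks ! m < length G" using c(5) by auto
    ultimately show ?thesis using nth[of "ks ! m"] c(6)[of m] that unfolding adj_def by blast
  qed
  \<comment> \<open>The rest of the cycle leads from \<open>vs ! 1\<close> around to
    \<open>vs ! 0\<close>, avoiding the position \<open>k\<close>.\<close>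
  have "(vs ! 1, vs ! m) \<in> (adj (u @ w))\<^sup>*" if "1 \<le> m" "m < length vs" for m
    using that
  proof (induction m rule: dec_induct)
    case (step m)
    then have "(vs ! m, vs ! Suc m) \<in> adj (u @ w)" using nbr[of m] by simp
    then show ?case using step by (simp add: rtrancl_into_rtrancl)
  qed simp
  from this[of "length vs - 1"] have "(vs ! 1, vs ! (length vs - 1)) \<in> (adj (u @ w))\<^sup>*" using c(1) by simp
  moreover have "(vs ! (length vs - 1), vs ! 0) \<in> adj (u @ w)" using nbr[of "length vs - 1"] c(1) \<open>vs \<noteq> []\<close> by simp
  ultimately have P: "(vs ! 1, vs ! 0) \<in> (adj (u @ w))\<^sup>*" by (rule rtrancl_into_rtrancl)
  then have P': "(vs ! 0, vs ! 1) \<in> (adj (u @ w))\<^sup>*" by (rule adj_rtrancl_sym)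
  have "adj G \<subseteq> (adj (u @ w))\<^sup>*"
  proof (clarify)
    fix x y assume "(x, y) \<in> adj G"
    then obtain e where e: "e \<in> set G" "endpoints e = {x, y}" by (auto simp: adj_def)
    show "(x, y) \<in> (adj (u @ w))\<^sup>*"
    proof (cases "e = G ! k")
      case True
      then have "{x, y} = {vs ! 0, vs ! 1}" using e0 e by simp
      then show ?thesis using P P' unfolding doubleton_eq_iff by blast
    next
      case False
      moreover have "e \<in> set (u @ G ! k # w)" using e(1) G by simp
      ultimately have "e \<in> set (u @ w)" by auto
      then have "(x, y) \<in> adj (u @ w)" using e unfolding adj_def by blast
      then show ?thesis by blast
    qed
  qed
  moreover have "set (u @ w) \<subseteq> set G" unfolding u_def w_def by (simp add: set_take_subset set_drop_subset)
  ultimately have closure: "(adj (u @ w))\<^sup>* = (adj G)\<^sup>*"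
    by (intro rtrancl_subset[OF adj_mono, symmetric])
  have "0 < length vs" "1 < length vs" using c(1) by auto
  then have "vs ! 0 \<noteq> vs ! 1" using c(2) by (simp add: nth_eq_iff_index_eq del: One_nat_def)
  then have "\<not> is_loop (G ! k)" using e0 by (cases "G ! k") (auto simp: doubleton_eq_iff)
  then show thesis by (rule that[OF G _ closure])
qed

lemma signed_graph_endpoints: "signed_graph n G \<Longrightarrow> e \<in> set G \<Longrightarrow> endpoints e \<subseteq> {1..n}"
  by (cases e) (auto simp: signed_graph_def signed_edges_def)

text \<open>There is one component, so the count becomes the lower bound n - 1 for the number of
  nonloop edges, attained exactly by forests.\<close>

lemma connected_labelling:
  assumes "signed_graph n G" "connected_graph n G" "1 \<le> n"
  shows "n \<le> Suc (nonloops G) \<and> (forest G \<longleftrightarrow> n = Suc (nonloops G))"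
proof -
  obtain f :: "nat \<Rightarrow> nat" where f: "\<And>u v. f u = f v \<longleftrightarrow> (u, v) \<in> (adj G)\<^sup>*"
    "n \<le> card (f ` {1..n}) + nonloops G" "forest G \<longleftrightarrow> n = card (f ` {1..n}) + nonloops G"
    using component_labelling[of "{1..n}" G] signed_graph_endpoints[OF assms(1)] by auto
  have "f v = f 1" if "v \<in> {1..n}" for v
    using f(1) assms(2,3) that unfolding connected_graph_adj by (metis atLeastAtMost_iff order_refl)
  moreover have "1 \<in> {1..n}" using assms(3) by simp
  ultimately have "f ` {1..n} = {f 1}" by blast
  then show ?thesis using f by simp
qed

lemma not_cycle_iff_count:
  assumes "signed_graph n G" "connected_graph n G" "1 \<le> n"
  shows "\<not> has_nonloop_cycle G \<longleftrightarrow> n = Suc (nonloops G)"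
proof
  show "n = Suc (nonloops G)" if "\<not> has_nonloop_cycle G"
    using not_cycle_forest[OF that] connected_labelling[OF assms] by blast
  show "\<not> has_nonloop_cycle G" if n: "n = Suc (nonloops G)"
  proof
    assume "has_nonloop_cycle G"
    \<comment> \<open>Without one edge of the cycle the graph is still connected, but it has only n
      - 2 nonloop edges.\<close>
    then obtain u e w where G: "G = u @ e # w" "\<not> is_loop e" "(adj (u @ w))\<^sup>* = (adj G)\<^sup>*"
      by (rule cycle_removable_edge)
    then have "signed_graph n (u @ w)" "connected_graph n (u @ w)"
      using assms by (auto simp: signed_graph_def connected_graph_adj)
    from connected_labelling[OF this assms(3)] show False using n G(1,2) by (simp add: nonloops_def)
  qed
qed

section \<open>Good graphs and reductions\<close>

text \<open>The condition \<open>length G = n\<close> stands for the absence of nonloop cycles: a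
  connected graph with one loop is acyclic exactly when it has n - 1 further edges. Unlike
  acyclicity, the length is visibly unchanged by replacing two edges by two others.\<close>

definition structured :: "nat \<Rightarrow> lgraph \<Rightarrow> bool" where
  "structured n G \<longleftrightarrow> signed_graph n G \<and> (\<forall>x\<in>set G. \<forall>y\<in>set G. \<not> conflict x y) \<and>
     connected_graph n G \<and> length (filter is_loop G) = 1 \<and> length G = n"

definition label_sorted :: "lgraph \<Rightarrow> bool" where
  "label_sorted G \<longleftrightarrow> sorted_wrt (\<lambda>x y. \<not> prec y x) G"

definition good :: "nat \<Rightarrow> lgraph \<Rightarrow> bool" where
  "good n G \<longleftrightarrow> structured n G \<and> label_sorted G"

section \<open>Translation of the conditions on graphs and labels\<close>

lemma no_conflict_iff:
  "(\<forall>x\<in>S. \<forall>y\<in>S. \<not> conflict x y) \<longleftrightarrow>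
     \<not> (\<exists>i j k l s t. i < j \<and> j < k \<and> k < l \<and> (i, k, s) \<in> S \<and> (j, l, t) \<in> S) \<and>
     (\<forall>i j k l. (i, j, Pos) \<in> S \<and> (k, l, Pos) \<in> S \<and> i < j \<and> k < l \<longrightarrow> i < l \<and> k < j) \<and>
     (\<forall>i k l. (i, i, Pos) \<in> S \<and> (k, l, Pos) \<in> S \<and> k < l \<longrightarrow> k \<le> i \<and> i \<le> l) \<and>
     \<not> (\<exists>i j k. (i, i, Pos) \<in> S \<and> (k, j, Neg) \<in> S \<and> k < i \<and> i < j) \<and>
     \<not> (\<exists>i j k l. (i, j, Pos) \<in> S \<and> (k, l, Neg) \<in> S \<and> k \<le> i \<and> i < j \<and> j \<le> l)"
  (is "?L \<longleftrightarrow> ?R")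
proof
  assume L: ?L
  then have *: "\<And>i k s j l t. (i, k, s) \<in> S \<Longrightarrow> (j, l, t) \<in> S \<Longrightarrow> \<not> conflict (i, k, s) (j, l, t)" by blast
  show ?R
  proof (intro conjI allI impI notI; (elim exE conjE)?)
    fix i j k l s t assume "i < j" "j < k" "k < l" "(i, k, s) \<in> S" "(j, l, t) \<in> S"
    then show False using *[of i k s j l t] by simp
  next
    fix i j k l assume "(i, j, Pos) \<in> S" "(k, l, Pos) \<in> S" "i < j" "k < l"
    then show "i < l" "k < j" using *[of i j Pos k l Pos] by auto
  next
    fix i k l assume "(i, i, Pos) \<in> S" "(k, l, Pos) \<in> S" "k < l"
    then show "k \<le> i" "i \<le> l" using *[of i i Pos k l Pos] by auto
  next
    fix i j k assume "(i, i, Pos) \<in> S" "(k, j, Neg) \<in> S" "k < i" "i < j"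
    then show False using *[of i i Pos k j Neg] by auto
  next
    fix i j k l assume "(i, j, Pos) \<in> S" "(k, l, Neg) \<in> S" "k \<le> i" "i < j" "j \<le> l"
    then show False using *[of i j Pos k l Neg] by auto
  qed
next
  assume R: ?R
  show ?L
  proof (intro ballI notI)
    fix x y assume xy: "x \<in> S" "y \<in> S" "conflict x y"
    obtain i k s j l t where e: "x = (i, k, s)" "y = (j, l, t)" by (cases x; cases y)
    from xy(3) show False unfolding e conflict.simps
      by (elim disjE) (use R xy(1,2) in \<open>(unfold e; blast)+\<close>)
  qed
qed

lemma well_structured_iff:
  assumes "signed_graph n G"
  shows "well_structured n G \<longleftrightarrow> structured n G"
proof -
  have "\<not> has_nonloop_cycle G \<longleftrightarrow> length G = n"
    if con: "connected_graph n G" and loop: "length (filter is_loop G) = 1"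
  proof -
    \<comment> \<open>The loop supplies a vertex, which excludes n = 0.\<close>
    obtain e where "e \<in> set G" using loop by (cases G) auto
    then have "1 \<le> n" using assms by (force simp: signed_graph_def signed_edges_def)
    moreover have "length G = Suc (nonloops G)"
      using sum_length_filter_compl[of is_loop G] loop by (simp add: nonloops_def)
    ultimately show ?thesis using not_cycle_iff_count[OF assms con] by auto
  qed
  then show ?thesis
    unfolding well_structured_def structured_def no_conflict_iff using assms by blast
qed

lemma well_labeled_iff: "well_labeled G \<longleftrightarrow> label_sorted G"
proof -
  have "well_labeled G \<longleftrightarrow>
      (\<forall>e f a b. labeled_edge G e a \<and> labeled_edge G f b \<and> prec e f \<longrightarrow> a < b)" (is "_ \<longleftrightarrow> ?R")
  proof
    assume W: "well_labeled G"
    show ?R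
    proof (intro allI impI; elim conjE)
      fix e f a b assume L: "labeled_edge G e a" "labeled_edge G f b" "prec e f"
      obtain i j s k l t where e: "e = (i, j, s)" "f = (k, l, t)" by (cases e; cases f)
      note L' = L[unfolded e]
      note w = W[unfolded well_labeled_def]
      note ws = w[THEN conjunct1, rule_format] w[THEN conjunct2, THEN conjunct1, rule_format]
        w[THEN conjunct2, THEN conjunct2, THEN conjunct1, rule_format]
        w[THEN conjunct2, THEN conjunct2, THEN conjunct2, THEN conjunct1, rule_format]
        w[THEN conjunct2, THEN conjunct2, THEN conjunct2, THEN conjunct2, THEN conjunct1, rule_format]
        w[THEN conjunct2, THEN conjunct2, THEN conjunct2, THEN conjunct2, THEN conjunct2, THEN conjunct1, rule_format]
        w[THEN conjunct2, THEN conjunct2, THEN conjunct2, THEN conjunct2, THEN conjunct2, THEN conjunct2, rule_format]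
      from L'(3)[unfolded prec.simps] show "a < b"
      proof (elim disjE conjE)
        assume "i < j" "j = k" "k < l"
        then show ?thesis using ws(1)[of i j s a l t b] L' by simp
      next
        assume "i = k" "k < l" "l < j"
        then show ?thesis using ws(2)[of i l t b j s a] L' by simp
      next
        assume "j = l" "k < i" "i < j"
        then show ?thesis using ws(3)[of k j t b i s a] L' by simp
      next
        assume "i = j" "k = i" "i < l" "s = Pos" "t = Neg"
        then show ?thesis using ws(4)[of i a l b] L' by simp
      next
        assume "k = l" "j = k" "i < j" "s = Neg" "t = Pos"
        then show ?thesis using ws(5)[of l b i a] L' by simp
      next
        assume "k = l" "i = k" "i < j" "s = Pos" "t = Pos"
        then show ?thesis using ws(6)[of k b j a] L' by simp
      next
        assume "i = j" "l = i" "k < l" "s = Pos" "t = Pos"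
        then show ?thesis using ws(7)[of l a k b] L' by simp
      qed
    qed
  next
    assume R: ?R
    then have *: "\<And>i j s a k l t b. labeled_edge G (i, j, s) a \<Longrightarrow> labeled_edge G (k, l, t) b \<Longrightarrow>
      prec (i, j, s) (k, l, t) \<Longrightarrow> a < b" by blast
    show "well_labeled G"
      unfolding well_labeled_def by (intro conjI allI impI; elim conjE; rule *, assumption+, simp)
  qed
  also have "\<dots> \<longleftrightarrow> (\<forall>p<length G. \<forall>q<length G. prec (G ! p) (G ! q) \<longrightarrow> p < q)" (is "_ \<longleftrightarrow> ?S")
  proof
    assume R: ?R
    show ?S
    proof (intro allI impI)
      fix p q assume "p < length G" "q < length G" "prec (G ! p) (G ! q)"
      then show "p < q" using R[rule_format, of "G ! p" "Suc p" "G ! q" "Suc q"]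
        by (simp add: labeled_edge_def)
    qed
  next
    assume S: ?S
    show ?R
    proof (intro allI impI; elim conjE)
      fix e f a b assume L: "labeled_edge G e a" "labeled_edge G f b" "prec e f"
      then have "a - 1 < b - 1" using S[rule_format, of "a - 1" "b - 1"] by (auto simp: labeled_edge_def)
      then show "a < b" by simp
    qed
  qed
  also have "\<dots> \<longleftrightarrow> label_sorted G"
  proof -
    \<comment> \<open>\<open>sorted_wrt\<close> says nothing about a pair of equal positions;
      irreflexivity of \<open>prec\<close> settles it.\<close>
    have "\<not> prec x x" for x by (cases x) auto
    have "p < q" if "\<forall>i j. i < j \<longrightarrow> j < length G \<longrightarrow> \<not> prec (G ! j) (G ! i)"
      "p < length G" "prec (G ! p) (G ! q)" for p q
    proof (rule ccontr)
      assume "\<not> p < q"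
      then have "q < p" using that(3) \<open>\<not> prec (G ! p) (G ! p)\<close> by (cases "p = q") auto
      then show False using that by blast
    qed
    then show ?thesis unfolding label_sorted_def sorted_wrt_iff_nth_less
      by (meson order_less_trans order_less_not_sym)
  qed
  finally show ?thesis .
qed

lemma connected_graph_cong:
  "(adj G)\<^sup>* = (adj H)\<^sup>* \<Longrightarrow> connected_graph n G \<longleftrightarrow> connected_graph n H"
  by (simp add: connected_graph_adj)

section \<open>Bridges and repeated edges\<close>

lemma structured_pos: "structured n G \<Longrightarrow> 1 \<le> n"
  unfolding structured_def by (cases G) auto

lemma structured_nonloops: "structured n G \<Longrightarrow> n = Suc (nonloops G)"
  using sum_length_filter_compl[of is_loop G] by (simp add: nonloops_def structured_def)

text \<open>If the ends of \<open>x\<close> stayed joined, n - 2 nonloop edges would connect all n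
  vertices.\<close>

lemma structured_bridge:
  assumes "structured n (u @ x # w)" "\<not> is_loop x" "endpoints x = {a, b}"
  shows "(a, b) \<notin> (adj (u @ w))\<^sup>*"
proof
  assume ab: "(a, b) \<in> (adj (u @ w))\<^sup>*"
  have "adj (u @ x # w) = adj (u @ w) \<union> {(a, b), (b, a)}"
    using assms(3) by (auto simp: adj_def doubleton_eq_iff)
  moreover have "(b, a) \<in> (adj (u @ w))\<^sup>*" using ab by (rule adj_rtrancl_sym)
  ultimately have "(adj (u @ x # w))\<^sup>* = (adj (u @ w))\<^sup>*"
    using ab by (intro rtrancl_subset) auto
  then have "connected_graph n (u @ w)" "signed_graph n (u @ w)"
    using assms(1) by (auto simp: structured_def signed_graph_def cong: connected_graph_cong)
  from connected_labelling[OF this(2,1) structured_pos[OF assms(1)]]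
  show False using structured_nonloops[OF assms(1)] assms(2) by (simp add: nonloops_def)
qed

lemma adj_append: "adj (u @ v) = adj u \<union> adj v"
  by (auto simp: adj_def)



text \<open>A second copy of a nonloop edge would bypass the first, and a second copy of a loop
  would be a second loop.\<close>

lemma structured_distinct:
  assumes "structured n G"
  shows "distinct G"
proof (rule ccontr)
  assume "\<not> distinct G"
  then obtain u y v w where G: "G = u @ y # (v @ y # w)"
    using not_distinct_decomp[of G] by auto
  obtain a b s where y: "y = (a, b, s)" by (cases y)
  show False
  proof (cases "is_loop y")
    case True
    then show False using assms unfolding structured_def G by simp
  next
    case False
    have "(a, b) \<in> adj (u @ (v @ y # w))" by (auto simp: adj_def y)
    then show False using structured_bridge[of n u y "v @ y # w" a b] assms False G y by auto
  qed
qed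

text \<open>Any two sides of a triangle connect its vertices; in the loop rule every reduct keeps an
  edge between \<open>i\<close> and \<open>j\<close>, and the reflexive closure absorbs the
  loops.\<close>

lemma edge_rule_adj:
  assumes "edge_rule e f rs" "(e', f') \<in> set rs"
  shows "adj [e, f] \<subseteq> (adj [e', f'])\<^sup>*"
proof -
  have tr: "(x, z) \<in> R\<^sup>*" if "(x, y) \<in> R" "(y, z) \<in> R" for R and x y z :: nat
    using that by (meson r_into_rtrancl rtrancl_into_rtrancl)
  show ?thesis
    using assms(1)
  proof (cases rule: edge_rule.cases)
    case (chain_rule i j k t)
    then show ?thesis using assms(2) by (auto simp: adj_Cons intro: tr[where y = i] tr[where y = k])
  next
    case (fork_rule i j k t t')
    then show ?thesis using assms(2) by (auto simp: adj_Cons intro: tr[where y = i] tr[where y = j])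
  next
    case (loop_rule i j)
    then show ?thesis using assms(2) by (auto simp: adj_Cons)
  qed
qed

lemma edge_rule_signed:
  assumes "edge_rule e f rs" "(e', f') \<in> set rs" "e \<in> signed_edges n" "f \<in> signed_edges n"
  shows "e' \<in> signed_edges n" "f' \<in> signed_edges n"
  using assms by (auto elim!: edge_rule.cases simp: signed_edges_def)

lemma edge_rule_loops:
  assumes "edge_rule e f rs" "(e', f') \<in> set rs"
  shows "length (filter is_loop [e', f']) = length (filter is_loop [e, f])"
  using assms by (auto elim!: edge_rule.cases)

lemma edge_rule_triangle:
  assumes "edge_rule e f rs" "p \<in> endpoints e \<union> endpoints f" "q \<in> endpoints e \<union> endpoints f"
  shows "(p, q) \<in> (adj [e, f])\<^sup>*"
proof -
  have *: "(p, q) \<in> R\<^sup>*" if "{p, q} \<subseteq> {a, b, c}" "{(a, b), (b, a), (b, c), (c, b)} \<subseteq> R"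
    for R and a b c :: nat
  proof -
    have r: "(a, b) \<in> R\<^sup>*" "(b, a) \<in> R\<^sup>*" "(b, c) \<in> R\<^sup>*" "(c, b) \<in> R\<^sup>*" using that(2) by auto
    then have "(a, c) \<in> R\<^sup>*" "(c, a) \<in> R\<^sup>*" by (meson rtrancl_trans)+
    then show ?thesis using r that(1) by auto
  qed
  show ?thesis
    using assms(1)
  proof (cases rule: edge_rule.cases)
    case (chain_rule i j k t)
    then show ?thesis using assms(2,3) by (intro *[of i j k]) (auto simp: adj_Cons)
  next
    case (fork_rule i j k t t')
    then show ?thesis using assms(2,3) by (intro *[of j k i]) (auto simp: adj_Cons)
  next
    case (loop_rule i j)
    then show ?thesis using assms(2,3) by (intro *[of i j j]) (auto simp: adj_Cons)
  qed
qed

lemma good_reduce: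
  assumes "good n (u @ [e, f] @ v)" "edge_rule e f rs" "(e', f') \<in> set rs"
  shows "good n (u @ [e', f'] @ v)"
proof -
  let ?G = "u @ [e, f] @ v" and ?H = "u @ [e', f'] @ v"
  have st: "structured n ?G" and so: "label_sorted ?G" using assms(1) by (auto simp: good_def)
  have sg: "signed_graph n ?G" and nc: "\<And>x y. x \<in> set ?G \<Longrightarrow> y \<in> set ?G \<Longrightarrow> \<not> conflict x y"
    and loops: "length (filter is_loop ?G) = 1"
    using st by (auto simp: structured_def)
  \<comment> \<open>An edge of \<open>u\<close> or \<open>v\<close> between two vertices met by
    \<open>e\<close> and \<open>f\<close> would close a cycle with them, and a loop there would be a
    second one beside \<open>f\<close>. These are the side conditions of
    \<open>edge_rule_left\<close> and \<open>edge_rule_right\<close>.\<close>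
  have tri: "\<not> (p < q \<and> {p, q} \<subseteq> endpoints e \<union> endpoints f)" and lp: "is_loop f \<longrightarrow> p < q"
    and pq: "p \<le> q" "s = Neg \<longrightarrow> p < q"
    if x: "(p, q, s) \<in> set u \<union> set v" for p q s
  proof -
    show pq: "p \<le> q" "s = Neg \<longrightarrow> p < q"
      using x sg by (auto simp: signed_graph_def signed_edges_def)
    from x obtain u' w where G: "?G = u' @ (p, q, s) # w" and sub: "{e, f} \<subseteq> set (u' @ w)"
    proof
      assume "(p, q, s) \<in> set u"
      then obtain a b where "u = a @ (p, q, s) # b" by (meson split_list)
      then show thesis using that[of a "b @ [e, f] @ v"] by simp
    next
      assume "(p, q, s) \<in> set v"
      then obtain a b where "v = a @ (p, q, s) # b" by (meson split_list)
      then show thesis using that[of "u @ [e, f] @ a" b] by simp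
    qed
    show "\<not> (p < q \<and> {p, q} \<subseteq> endpoints e \<union> endpoints f)"
    proof
      assume a: "p < q \<and> {p, q} \<subseteq> endpoints e \<union> endpoints f"
      then have "(p, q) \<in> (adj [e, f])\<^sup>*" using edge_rule_triangle[OF assms(2)] by blast
      moreover have "(adj [e, f])\<^sup>* \<subseteq> (adj (u' @ w))\<^sup>*"
        using sub by (intro rtrancl_mono adj_mono) auto
      ultimately show False
        using structured_bridge[of n u' "(p, q, s)" w p q] st a unfolding G by auto
    qed
    show "is_loop f \<longrightarrow> p < q"
    proof (rule impI, rule ccontr)
      assume f: "is_loop f" and "\<not> p < q"
      then have "is_loop (p, q, s)" using pq by simp
      then have "\<exists>y\<in>set u \<union> set v. is_loop y" using x by blast
      then have "filter is_loop u \<noteq> [] \<or> filter is_loop v \<noteq> []" by (auto simp: filter_empty_conv)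
      then show False using loops f by (auto split: if_splits)
    qed
  qed
  have ncl: "\<not> clash x y" if "x \<in> set ?G" "y \<in> set ?G" for x y
    using nc that by (auto simp: clash_def)
  have L: "\<not> clash x e' \<and> \<not> clash x f' \<and> \<not> prec e' x \<and> \<not> prec f' x" if x: "x \<in> set u" for x
  proof -
    obtain p q s where e: "x = (p, q, s)" by (cases x)
    have "\<not> prec e x \<and> \<not> prec f x" using so x by (auto simp: label_sorted_def sorted_wrt_append)
    then show ?thesis
      using edge_rule_left[OF assms(2,3) ncl ncl e pq tri lp] x unfolding e by auto
  qed
  have R: "\<not> clash x e' \<and> \<not> clash x f' \<and> \<not> prec x e' \<and> \<not> prec x f'" if x: "x \<in> set v" for x
  proof -
    obtain p q s where e: "x = (p, q, s)" by (cases x)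
    have "\<not> prec x e \<and> \<not> prec x f" using so x by (auto simp: label_sorted_def sorted_wrt_append)
    then show ?thesis
      using edge_rule_right[OF assms(2,3) ncl ncl e pq tri lp] x unfolding e by auto
  qed
  have S: "\<not> clash e' f' \<and> \<not> clash e' e' \<and> \<not> clash f' f' \<and> \<not> prec f' e'"
    using edge_rule_self[OF assms(2,3) ncl] by simp
  have "label_sorted ?H" using so L R S by (auto simp: label_sorted_def sorted_wrt_append)
  moreover have "signed_graph n ?H"
    using sg edge_rule_signed[OF assms(2,3)] by (auto simp: signed_graph_def)
  moreover have "\<not> conflict x y" if "x \<in> set ?H" "y \<in> set ?H" for x y
  proof -
    have A: "\<not> clash x y" if "x \<in> set u \<union> set v" "y \<in> {e', f'}" for x y
      using that L[of x] R[of x] by blast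
    have B: "\<not> clash x y" if "x \<in> set u \<union> set v" "y \<in> set u \<union> set v" for x y
      using that ncl by auto
    have "x \<in> set u \<union> set v \<or> x \<in> {e', f'}" "y \<in> set u \<union> set v \<or> y \<in> {e', f'}"
      using that by auto
    then have "\<not> clash x y"
      by (elim disjE) (use A[of x y] A[of y x] B[of x y] S in \<open>auto simp: clash_def\<close>)
    then show ?thesis by (simp add: clash_def)
  qed
  moreover have "connected_graph n ?H"
  proof -
    have "adj ?G \<subseteq> (adj ?H)\<^sup>*"
    proof -
      have "(adj [e', f'])\<^sup>* \<subseteq> (adj ?H)\<^sup>*" by (intro rtrancl_mono adj_mono) auto
      moreover have "adj u \<subseteq> (adj ?H)\<^sup>*" "adj v \<subseteq> (adj ?H)\<^sup>*"
        using adj_mono[of u ?H] adj_mono[of v ?H] by auto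
      moreover have "adj ?G = adj u \<union> (adj [e, f] \<union> adj v)" by (simp only: adj_append)
      ultimately show ?thesis using edge_rule_adj[OF assms(2,3)] by (simp only:) blast
    qed
    then have "(adj ?G)\<^sup>* \<subseteq> (adj ?H)\<^sup>*" by (rule rtrancl_subset_rtrancl)
    then show ?thesis using st unfolding structured_def connected_graph_adj by blast
  qed
  moreover have "length (filter is_loop ?H) = 1"
    using loops edge_rule_loops[OF assms(2,3)] unfolding filter_append length_append by simp
  moreover have "length ?H = n" using st by (simp add: structured_def)
  ultimately show ?thesis unfolding good_def structured_def by blast
qed

section \<open>Commutations and reducible pairs\<close>

lemma edge_letter_eq_iff [simp]:
  "edge_letter (i, j, s) = X a b \<longleftrightarrow> s = Neg \<and> i = a \<and> j = b"
  "edge_letter (i, j, s) = Y a b \<longleftrightarrow> s = Pos \<and> i \<noteq> j \<and> i = a \<and> j = b"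
  "edge_letter (i, j, s) = Z a \<longleftrightarrow> s = Pos \<and> i = j \<and> i = a"
  by (cases s; auto)+

lemma indices_edge_letter: "indices (edge_letter e) = endpoints e"
  by (cases e rule: edge_letter.cases) auto

lemma inj_edge_letter: "inj edge_letter"
proof (rule injI)
  fix e f assume "edge_letter e = edge_letter f"
  then show "e = f" by (cases e rule: edge_letter.cases; cases f rule: edge_letter.cases) (auto split: if_splits)
qed

lemma graph_monomial_eq_iff [simp]: "graph_monomial G = graph_monomial H \<longleftrightarrow> G = H"
  unfolding graph_monomial_def using inj_edge_letter by (simp add: inj_map_eq_map)

lemma reduction_rule_edge_rule:
  assumes "reduction_rule (edge_letter e) (edge_letter f) rs" "\<not> prec f e"
  shows "\<exists>rs'. edge_rule e f rs' \<and> rs = map (\<lambda>(e', f'). [edge_letter e', edge_letter f']) rs'"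
proof -
  obtain i j s k l t where e: "e = (i, j, s)" "f = (k, l, t)" by (cases e; cases f)
  from assms(1) show ?thesis
  proof (cases rule: reduction_rule.cases)
    case (xx_rule a b c)
    then show ?thesis using chain_rule[of a b c Neg] e by (intro exI conjI) auto
  next
    case (xx_rule' a b c)
    then show ?thesis using assms(2) e by simp
  next
    case (xy_rule a b c)
    then show ?thesis using chain_rule[of a b c Pos] e by (intro exI conjI) auto
  next
    case (xy_rule' a b c)
    then show ?thesis using assms(2) e by simp
  next
    case (x_y_rule a b c)
    then show ?thesis using assms(2) e by simp
  next
    case (x_y_rule' a b c)
    then show ?thesis using fork_rule[of a b c Pos Neg] e by (intro exI conjI) auto
  next
    case (yx_rule a b c)
    then show ?thesis using assms(2) e by simp
  next
    case (yx_rule' a b c)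
    then show ?thesis using fork_rule[of a b c Neg Pos] e by (intro exI conjI) auto
  next
    case (xz_rule a b)
    then show ?thesis using loop_rule[of a b] e by (intro exI conjI) auto
  next
    case (xz_rule' a b)
    then show ?thesis using assms(2) e by simp
  qed
qed

text \<open>\<open>prec\<close> relates only edges with a common vertex, so exchanging disjoint
  neighbours respects the labeling.\<close>

lemma good_swap:
  assumes "good n (u @ [e, f] @ v)" "endpoints e \<inter> endpoints f = {}"
  shows "good n (u @ [f, e] @ v)"
proof -
  have set: "set (u @ [f, e] @ v) = set (u @ [e, f] @ v)" by auto
  have "adj (u @ [f, e] @ v) = adj (u @ [e, f] @ v)" unfolding adj_def set ..
  then have "connected_graph n (u @ [f, e] @ v) \<longleftrightarrow> connected_graph n (u @ [e, f] @ v)"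
    by (simp add: connected_graph_adj)
  moreover have "\<not> prec e f \<and> \<not> prec f e"
    using assms(2) by (cases e; cases f) auto
  ultimately show ?thesis
    using assms(1) set unfolding good_def structured_def signed_graph_def label_sorted_def
    by (auto simp: sorted_wrt_append)
qed

section \<open>Words modulo commutations\<close>

lemma comm_equiv_refl [simp]: "comm_equiv w w"
  by (simp add: comm_equiv_def)

lemma comm_equiv_trans [trans]: "comm_equiv u v \<Longrightarrow> comm_equiv v w \<Longrightarrow> comm_equiv u w"
  by (simp add: comm_equiv_def)

lemma comm_swap_sym: "comm_swap u v \<Longrightarrow> comm_swap v u"
  by (auto elim!: comm_swap.cases) (metis Int_commute append_Cons append_Nil comm_swap.intros)

lemma comm_equiv_sym: "comm_equiv u v \<Longrightarrow> comm_equiv v u"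
  unfolding comm_equiv_def
  by (induction rule: rtranclp_induct) (auto intro: converse_rtranclp_into_rtranclp comm_swap_sym)

lemma comm_swap_context: "comm_swap u v \<Longrightarrow> comm_swap (x @ u @ y) (x @ v @ y)"
proof (induction rule: comm_swap.induct)
  case (1 a b u v)
  then show ?case using comm_swap.intros[of a b "x @ u" "v @ y"] by simp
qed

lemma comm_equiv_context: "comm_equiv u v \<Longrightarrow> comm_equiv (x @ u @ y) (x @ v @ y)"
  unfolding comm_equiv_def
proof (induction rule: rtranclp_induct)
  case (step v w)
  then show ?case using comm_swap_context[of v w x y] by (meson rtranclp.rtrancl_into_rtrancl)
qed simp

lemma comm_equiv_append: "comm_equiv u u' \<Longrightarrow> comm_equiv v v' \<Longrightarrow> comm_equiv (u @ v) (u' @ v')"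
  using comm_equiv_context[of u u' "[]" v] comm_equiv_context[of v v' u' "[]"]
  by (auto intro: comm_equiv_trans)

lemma comm_equiv_move:
  assumes "\<And>x. x \<in> set m \<Longrightarrow> indices a \<inter> indices x = {}"
  shows "comm_equiv (a # m) (m @ [a])"
  using assms
proof (induction m)
  case (Cons x m)
  have "comm_equiv (a # x # m) (x # a # m)"
    using comm_swap.intros[of a x "[]" m] Cons.prems[of x] by (simp add: comm_equiv_def r_into_rtranclp)
  also have "comm_equiv \<dots> (x # m @ [a])"
    using comm_equiv_append[of "[x]" "[x]" "a # m" "m @ [a]"] Cons by simp
  finally show ?case by simp
qed simp

text \<open>A letter with \<open>P\<close> has to pass only letters without \<open>P\<close>.
  Letters of the same class keep their order, so nothing is required of them.\<close>

lemma comm_equiv_partition: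
  assumes "\<And>x y. x \<in> set m \<Longrightarrow> y \<in> set m \<Longrightarrow> P x \<Longrightarrow> \<not> P y \<Longrightarrow> indices x \<inter> indices y = {}"
  shows "comm_equiv m (filter (\<lambda>x. \<not> P x) m @ filter P m)"
  using assms
proof (induction m)
  case (Cons x m)
  then have IH: "comm_equiv m (filter (\<lambda>x. \<not> P x) m @ filter P m)" by simp
  have "comm_equiv (x # m) ([x] @ filter (\<lambda>x. \<not> P x) m @ filter P m)"
    using comm_equiv_append[OF comm_equiv_refl[of "[x]"] IH] by simp
  also have "comm_equiv \<dots> (filter (\<lambda>x. \<not> P x) (x # m) @ filter P (x # m))"
  proof (cases "P x")
    case True
    have "comm_equiv (x # filter (\<lambda>x. \<not> P x) m) (filter (\<lambda>x. \<not> P x) m @ [x])"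
      by (rule comm_equiv_move) (use Cons.prems True in auto)
    from comm_equiv_append[OF this comm_equiv_refl[of "filter P m"]] show ?thesis using True by simp
  qed simp
  finally show ?case .
qed simp

lemma good_comm_swap:
  assumes "comm_swap (graph_monomial G) w" "good n G"
  shows "\<exists>H. w = graph_monomial H \<and> good n H \<and> set H = set G"
  using assms(1)
proof (cases rule: comm_swap.cases)
  case (1 a b u v)
  then obtain U e f V where G: "G = U @ [e, f] @ V" and l: "u = map edge_letter U" "a = edge_letter e"
    "b = edge_letter f" "v = map edge_letter V"
    unfolding graph_monomial_def by (auto simp: map_eq_append_conv map_eq_Cons_conv Cons_eq_map_conv)
  have "good n (U @ [f, e] @ V)"
    using good_swap assms(2) 1(3) unfolding G l indices_edge_letter by blast
  then show ?thesis using 1 l G by (intro exI[of _ "U @ [f, e] @ V"]) (auto simp: graph_monomial_def)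
qed

lemma good_comm_equiv:
  assumes "comm_equiv (graph_monomial G) w" "good n G"
  shows "\<exists>H. w = graph_monomial H \<and> good n H \<and> set H = set G"
  using assms(1) unfolding comm_equiv_def
proof (induction rule: rtranclp_induct)
  case base
  then show ?case using assms(2) by blast
next
  case (step v w)
  then show ?case using good_comm_swap by metis
qed

text \<open>\<open>label_sorted\<close> survives commutations and excludes the rules whose letters
  stand in the wrong order, so reductions of words become edge rules. The edge set, on which the
  cone depends, is kept.\<close>

lemma good_reduction:
  assumes "good n G" "comm_equiv (graph_monomial G) (u @ [a, b] @ v)" "reduction_rule a b rs"
  obtains U e f V rs' where "good n (U @ [e, f] @ V)" "set (U @ [e, f] @ V) = set G"
    "edge_rule e f rs'" "rs = map (\<lambda>(e', f'). [edge_letter e', edge_letter f']) rs'"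
    "u = map edge_letter U" "v = map edge_letter V"
proof -
  from good_comm_equiv[OF assms(2,1)] obtain H where H: "u @ [a, b] @ v = graph_monomial H"
    "good n H" "set H = set G" by auto
  then obtain U e f V where G: "H = U @ [e, f] @ V" and l: "u = map edge_letter U" "a = edge_letter e"
    "b = edge_letter f" "v = map edge_letter V"
    unfolding graph_monomial_def by (auto simp: append_eq_map_conv Cons_eq_map_conv)
  have "\<not> prec f e" using H(2) unfolding G good_def label_sorted_def by (simp add: sorted_wrt_append)
  from reduction_rule_edge_rule[OF assms(3)[unfolded l] this] show thesis
    using that H(2,3) l unfolding G by blast
qed

text \<open>The lexicographic order as a linear order of triples, so that \<open>sort_key\<close>
  produces lexicographic labels. The entries are negated integers because larger indices come
  first.\<close>

fun edge_key :: "edge \<Rightarrow> int \<times> int \<times> int" where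
  "edge_key (i, j, s) = (if s = Pos then 0 else 1, - int j, - int i)"

lemma edge_less_iff_key: "edge_less e f \<longleftrightarrow> edge_key e < edge_key f"
  by (cases e; cases f; cases "snd (snd e)"; cases "snd (snd f)") (auto simp: less_prod_def)

lemma inj_edge_key: "inj edge_key"
proof (rule injI)
  fix e f assume "edge_key e = edge_key f"
  then show "e = f" by (cases e; cases f; cases "snd (snd e)"; cases "snd (snd f)") auto
qed

lemma comm_equiv_insort:
  assumes "\<And>x. x \<in> set L \<Longrightarrow> edge_key x < edge_key e \<Longrightarrow> endpoints x \<inter> endpoints e = {}"
  shows "comm_equiv (graph_monomial (insort_key edge_key e L)) (graph_monomial (e # L))"
  using assms
proof (induction L)
  case (Cons x L)
  show ?case
  proof (cases "edge_key e \<le> edge_key x")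
    case False
    then have "indices (edge_letter e) \<inter> indices (edge_letter x) = {}"
      using Cons.prems[of x] by (auto simp: indices_edge_letter not_le)
    then have "comm_swap (edge_letter e # edge_letter x # graph_monomial L)
        (edge_letter x # edge_letter e # graph_monomial L)"
      using comm_swap.intros[of _ _ "[]"] by simp
    then have 1: "comm_equiv (edge_letter x # edge_letter e # graph_monomial L) (graph_monomial (e # x # L))"
      using comm_swap_sym by (auto simp: comm_equiv_def graph_monomial_def)
    have "comm_equiv (graph_monomial (insort_key edge_key e L)) (graph_monomial (e # L))"
      using Cons by simp
    from comm_equiv_append[OF comm_equiv_refl[of "[edge_letter x]"] this] 1 show ?thesis
      using False by (auto simp: graph_monomial_def intro: comm_equiv_trans)
  qed simp
qed (simp add: graph_monomial_def)

text \<open>Insertion sort moves an edge only past later edges of smaller key, and with these it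
  commutes.\<close>

lemma comm_equiv_sort:
  assumes "sorted_wrt (\<lambda>e x. edge_key x < edge_key e \<longrightarrow> endpoints x \<inter> endpoints e = {}) L"
  shows "comm_equiv (graph_monomial (sort_key edge_key L)) (graph_monomial L)"
  using assms
proof (induction L)
  case (Cons e L)
  have "comm_equiv (graph_monomial (insort_key edge_key e (sort_key edge_key L)))
      (graph_monomial (e # sort_key edge_key L))"
    by (rule comm_equiv_insort) (use Cons.prems in auto)
  moreover have "comm_equiv (graph_monomial (e # sort_key edge_key L)) (graph_monomial (e # L))"
    using comm_equiv_append[OF comm_equiv_refl[of "[edge_letter e]"]] Cons by (simp add: graph_monomial_def)
  ultimately show ?case by (simp add: comm_equiv_trans)
qed simp

text \<open>Among edges that meet with equal signs the order demanded by well-labeling is the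
  lexicographic one. The absence of clashes matters: positive edges (i, j), (j, k) with i < j < k
  are ordered oppositely by the two, but they violate condition (ii).\<close>

lemma alternating_key_prec:
  assumes "incidence_sign e v = incidence_sign f v" "v \<in> endpoints e" "v \<in> endpoints f"
    and "e \<in> signed_edges n" "f \<in> signed_edges n" "\<not> clash e f" "edge_key e < edge_key f"
    and "endpoints e = endpoints f \<longrightarrow> is_loop e"
  shows "prec e f"
proof -
  obtain i j s k l t where e: "e = (i, j, s)" "f = (k, l, t)" by (cases e; cases f)
  obtain I J K L V where R: "real i = I" "real j = J" "real k = K" "real l = L" "real v = V" by blast
  \<comment> \<open>\<open>incidence_sign\<close> is eliminated, so that only signs and the order of
    vertices are left for \<open>argo\<close>.\<close>
  have sign_iff: "incidence_sign (i, j, s) v = Pos \<longleftrightarrow> s = Pos \<or> v = i" for i j s by (cases s) auto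
  have sg: "s = Pos \<or> v = i \<longleftrightarrow> t = Pos \<or> v = k" using assms(1) sign_iff unfolding e by metis
  have ends: "v = i \<or> v = j" "v = k \<or> v = l" "i \<le> j" "k \<le> l" "s = Neg \<longrightarrow> i < j" "t = Neg \<longrightarrow> k < l"
    "\<not> (i = k \<and> j = l \<and> i < j)"
    using assms(2-5,8) unfolding e by (auto simp: signed_edges_def)
  have less: "edge_less (i, j, s) (k, l, t)" using assms(7) e by (simp add: edge_less_iff_key)
  note ncl = assms(6)[unfolded e clash_def conflict.simps]
  show ?thesis unfolding e prec.simps
    by (insert sg ends less[unfolded edge_less.simps] ncl, cases s; cases t; simp only: order_real_simps R;
      thin_tac "s = _", thin_tac "t = _"; argo)
qed

section \<open>Nonalternating graphs are reducible\<close>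

lemma nonparallel:
  assumes "structured n (u @ e # m @ f # w)" "endpoints e = endpoints f"
  shows "is_loop e"
proof (rule ccontr)
  assume "\<not> is_loop e"
  obtain a b s where e: "e = (a, b, s)" by (cases e)
  have "(a, b) \<in> adj (u @ m @ f # w)" using assms(2) e by (auto simp: adj_def)
  then show False using structured_bridge[OF assms(1) \<open>\<not> is_loop e\<close>, of a b] e by auto
qed

text \<open>One edge is negative at \<open>v\<close>, hence of the form \<open>(i, v, Neg)\<close>,
  and the other is positive at \<open>v\<close>. The rule is selected by the position of the far end
  of the latter: beyond \<open>v\<close>, at \<open>v\<close>, between \<open>i\<close> and
  \<open>v\<close>, or below \<open>i\<close>. Both orders of the letters are treated, as either
  edge may be the negative one.\<close>

lemma opposite_signs_rule:
  assumes "v \<in> endpoints e" "v \<in> endpoints f" "incidence_sign e v \<noteq> incidence_sign f v"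
    and "e \<in> signed_edges n" "f \<in> signed_edges n" "endpoints e = endpoints f \<longrightarrow> is_loop e"
  shows "\<exists>rs. reduction_rule (edge_letter e) (edge_letter f) rs"
proof -
  have *: "(\<exists>rs. reduction_rule (X i v) (edge_letter (j, k, t)) rs) \<and>
      (\<exists>rs. reduction_rule (edge_letter (j, k, t)) (X i v) rs)"
    if "i < v" "v \<in> {j, k}" "j \<le> k" "t = Neg \<longrightarrow> j < k" "incidence_sign (j, k, t) v = Pos" "{j, k} \<noteq> {i, v}"
    for i j k t
  proof (cases "j = v")
    case True
    show ?thesis
    proof (cases "v = k")
      case True
      then have "t = Pos" using that \<open>j = v\<close> by (cases t) auto
      then show ?thesis using xz_rule[of i v] xz_rule'[of i v] that(1) True \<open>j = v\<close> by auto
    next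
      case False
      then have "v < k" using that True by simp
      then show ?thesis
        using xx_rule[of i v k] xx_rule'[of i v k] xy_rule[of i v k] xy_rule'[of i v k] that(1) True
        by (cases t) auto
    qed
  next
    case False
    then have "k = v" "t = Pos" using that by (cases t; auto)+
    show ?thesis
    proof (cases "i < j")
      case True
      then show ?thesis using x_y_rule[of i j v] x_y_rule'[of i j v] that False \<open>k = v\<close> \<open>t = Pos\<close> by auto
    next
      case False
      then have "j < i" using that \<open>k = v\<close> by auto
      then show ?thesis using yx_rule[of j i v] yx_rule'[of j i v] that \<open>i < v\<close> \<open>k = v\<close> \<open>t = Pos\<close> by auto
    qed
  qed
  obtain i j s k l t where e: "e = (i, j, s)" "f = (k, l, t)" by (cases e; cases f)
  show ?thesis
  proof (cases "incidence_sign e v")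
    case Neg
    then have "s = Neg" "j = v" "i < v" using assms e by (cases s; auto simp: signed_edges_def split: if_splits)+
    moreover have "incidence_sign f v = Pos" using Neg assms(3) by (metis sign.exhaust)
    ultimately show ?thesis using *[of i k l t] assms e by (auto simp: signed_edges_def)
  next
    case Pos
    then have "incidence_sign f v = Neg" using assms(3) by (metis sign.exhaust)
    then have "t = Neg" "l = v" "k < v" using assms e by (cases t; auto simp: signed_edges_def split: if_splits)+
    then show ?thesis using *[of k i j s] Pos assms e by (auto simp: signed_edges_def)
  qed
qed

text \<open>Induction on the number of edges between \<open>e\<close> and \<open>f\<close>. One of
  them that contains \<open>v\<close> differs in sign there from \<open>e\<close> or from
  \<open>f\<close> and gives a closer pair. If none does, those connected with the far end of
  \<open>e\<close> inside \<open>M\<close> commute to the right past \<open>f\<close>, and all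
  others to the left past \<open>e\<close>.\<close>

lemma nonalternating_reducible_at:
  assumes "structured n G" "G = U @ e # M @ f # W" "v \<in> endpoints e" "v \<in> endpoints f"
    "incidence_sign e v \<noteq> incidence_sign f v"
  shows "\<exists>u a b w rs. comm_equiv (graph_monomial G) (u @ [a, b] @ w) \<and> reduction_rule a b rs"
  using assms(2-)
proof (induction "length M" arbitrary: U e M f W rule: less_induct)
  case less
  note G = less.prems(1)
  show ?case
  proof (cases "\<exists>x\<in>set M. v \<in> endpoints x")
    case True
    then obtain x M1 M2 where M: "M = M1 @ x # M2" "v \<in> endpoints x" by (meson split_list)
    show ?thesis
    proof (cases "incidence_sign e v = incidence_sign x v")
      case True
      then show ?thesis
        using less.hyps[of M2 "U @ e # M1" x f W] less.prems M by simp
    next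
      case False
      then show ?thesis
        using less.hyps[of M1 U e x "M2 @ f # W"] less.prems M by simp
    qed
  next
    case False
    obtain c where c: "endpoints e = {c, v}" using less.prems(2) by (cases e) auto
    obtain w where w: "endpoints f = {w, v}" using less.prems(3) by (cases f) auto
    define C where "C = {y. (c, y) \<in> (adj M)\<^sup>*}"
    define P where "P = (\<lambda>x. endpoints x \<subseteq> C)"
    have meet: "P x" if "x \<in> set M" "endpoints x \<inter> C \<noteq> {}" for x
    proof -
      obtain a b s where x: "x = (a, b, s)" by (cases x)
      have "(a, b) \<in> adj M" "(b, a) \<in> adj M" using that(1) x by (force simp: adj_def)+
      then show ?thesis using that(2) unfolding P_def C_def x
        by (auto intro: rtrancl_into_rtrancl)
    qed
    have eM: "endpoints e \<inter> endpoints x = {}" if "x \<in> set M" "\<not> P x" for x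
    proof -
      have "c \<in> C" by (simp add: C_def)
      then have "c \<notin> endpoints x" using meet[OF that(1)] that(2) by blast
      moreover have "v \<notin> endpoints x" using False that(1) by blast
      ultimately show ?thesis using c by simp
    qed
    \<comment> \<open>An edge of the component of \<open>c\<close> could meet \<open>f\<close> only
      at \<open>w\<close>, since \<open>v\<close> does not occur in \<open>M\<close>. Then
      \<open>e\<close>, a path in \<open>M\<close> and \<open>f\<close> would form a cycle.\<close>
    have fM: "endpoints x \<inter> endpoints f = {}" if "x \<in> set M" "P x" for x
    proof (rule ccontr)
      assume "endpoints x \<inter> endpoints f \<noteq> {}"
      then have wx: "w \<in> endpoints x" "v \<notin> endpoints x" using False that w by auto
      then have cw: "(c, w) \<in> (adj M)\<^sup>*" using that by (auto simp: P_def C_def)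
      show False
      proof (cases "c = v")
        \<comment> \<open>Here \<open>e\<close> is a loop, and its component in \<open>M\<close> is
          the vertex \<open>v\<close> alone.\<close>
        case True
        have "(v, y) \<notin> adj M" for y using False by (auto simp: adj_def)
        then have "w = v" using cw True by (metis converse_rtranclE)
        then show False using wx by simp
      next
        case cv: False
        have "(adj M)\<^sup>* \<subseteq> (adj (U @ M @ f # W))\<^sup>*" by (intro rtrancl_mono adj_mono) auto
        moreover have "(w, v) \<in> adj (U @ M @ f # W)" using w by (auto simp: adj_def)
        ultimately have "(c, v) \<in> (adj (U @ M @ f # W))\<^sup>*" using cw by (meson rtrancl.rtrancl_into_rtrancl subsetD)
        moreover have "\<not> is_loop e" using c cv by (cases e) (auto simp: doubleton_eq_iff)
        ultimately show False using structured_bridge[of n U e "M @ f # W" c v] assms(1) c unfolding G by blast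
      qed
    qed
    let ?m = "map edge_letter"
    let ?N = "filter (\<lambda>x. \<not> P x) M" and ?Q = "filter P M"
    have part: "comm_equiv (?m M) (?m ?N @ ?m ?Q)"
    proof -
      define R where "R = (\<lambda>a. indices a \<subseteq> C)"
      have R: "R (edge_letter x) \<longleftrightarrow> P x" for x by (simp add: R_def P_def indices_edge_letter)
      have "comm_equiv (?m M) (filter (\<lambda>a. \<not> R a) (?m M) @ filter R (?m M))"
      proof (rule comm_equiv_partition)
        fix a b assume "a \<in> set (?m M)" "b \<in> set (?m M)" "R a" "\<not> R b"
        then obtain x y where xy: "x \<in> set M" "y \<in> set M" "a = edge_letter x" "b = edge_letter y" "P x" "\<not> P y"
          using R by auto
        then have "endpoints y \<inter> C = {}" "endpoints x \<subseteq> C" using meet[of y] by (blast, simp add: P_def)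
        then show "indices a \<inter> indices b = {}" using xy by (auto simp: indices_edge_letter)
      qed
      then show ?thesis by (simp add: filter_map o_def R)
    qed
    have "graph_monomial G = ?m U @ [edge_letter e] @ ?m M @ [edge_letter f] @ ?m W"
      by (simp add: graph_monomial_def G)
    also have "comm_equiv \<dots> (?m U @ [edge_letter e] @ (?m ?N @ ?m ?Q) @ [edge_letter f] @ ?m W)"
      by (intro comm_equiv_append comm_equiv_refl part)
    also have "\<dots> = ?m U @ (edge_letter e # ?m ?N) @ (?m ?Q @ [edge_letter f]) @ ?m W" by simp
    also have "comm_equiv \<dots> (?m U @ (?m ?N @ [edge_letter e]) @ (edge_letter f # ?m ?Q) @ ?m W)"
    proof (intro comm_equiv_append comm_equiv_refl)
      show "comm_equiv (edge_letter e # ?m ?N) (?m ?N @ [edge_letter e])"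
        by (rule comm_equiv_move) (use eM in \<open>auto simp: indices_edge_letter\<close>)
      show "comm_equiv (?m ?Q @ [edge_letter f]) (edge_letter f # ?m ?Q)"
        by (rule comm_equiv_sym, rule comm_equiv_move) (use fM in \<open>auto simp: indices_edge_letter\<close>)
    qed
    also have "\<dots> = (?m U @ ?m ?N) @ [edge_letter e, edge_letter f] @ (?m ?Q @ ?m W)" by simp
    finally have "comm_equiv (graph_monomial G)
      ((?m U @ ?m ?N) @ [edge_letter e, edge_letter f] @ (?m ?Q @ ?m W))" .
    moreover have "\<exists>rs. reduction_rule (edge_letter e) (edge_letter f) rs"
    proof (rule opposite_signs_rule[OF less.prems(2-4)])
      show "e \<in> signed_edges n" "f \<in> signed_edges n"
        using assms(1) unfolding G by (auto simp: structured_def signed_graph_def)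
      show "endpoints e = endpoints f \<longrightarrow> is_loop e" using nonparallel assms(1) unfolding G by blast
    qed
    ultimately show ?thesis by blast
  qed
qed

lemma irreducible_alternating:
  assumes "structured n G"
    and "\<not> (\<exists>u a b w rs. comm_equiv (graph_monomial G) (u @ [a, b] @ w) \<and> reduction_rule a b rs)"
  shows "alternating n G"
  unfolding alternating_def
proof (intro ballI impI, rule ccontr)
  fix v e f assume a: "e \<in> set G" "f \<in> set G" "v \<in> endpoints e \<and> v \<in> endpoints f"
    "incidence_sign e v \<noteq> incidence_sign f v"
  then have "e \<noteq> f" by auto
  with a(1,2) have "(\<exists>u m w. G = u @ e # m @ f # w) \<or> (\<exists>u m w. G = u @ f # m @ e # w)"
    by (metis in_set_conv_decomp append_Cons append_assoc append_Nil Un_iff set_append set_ConsD)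
  then show False using nonalternating_reducible_at[OF assms(1)] a assms(2) by metis
qed

section \<open>Cones of reduced graphs\<close>

text \<open>The linear functional with coefficients \<open>y\<close>, evaluated at the edge vector,
  in a form free of the sum over the vertices.\<close>

fun pairing :: "(nat \<Rightarrow> real) \<Rightarrow> edge \<Rightarrow> real" where
  "pairing y (i, j, Neg) = y i - y j"
| "pairing y (i, j, Pos) = y i + y j"

lemma pairing_edge_vec:
  assumes "e \<in> signed_edges n"
  shows "(\<Sum>k=1..n. y k * edge_vec e k) = pairing y e"
proof -
  have *: "(\<Sum>k=1..n. y k * unit_vec i k) = y i" if "i \<in> {1..n}" for i
    using that by (simp add: unit_vec_def if_distrib[of "\<lambda>x. _ * x"] cong: if_cong)
  obtain i j s where e: "e = (i, j, s)" by (cases e)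
  have ij: "i \<in> {1..n}" "j \<in> {1..n}" using assms e by (auto simp: signed_edges_def)
  show ?thesis
    using *[OF ij(1)] *[OF ij(2)] unfolding e
    by (cases s) (simp_all add: algebra_simps sum.distrib sum_subtractf)
qed

text \<open>
  The solution \<open>\<sigma>\<close> of the homogeneous system is what allows \<open>y\<close> to be adjusted on one component
  when an edge joins two components.
\<close>

lemma forest_pairing:
  assumes "forest G"
  shows "(\<exists>\<sigma>. (\<forall>v. \<sigma> v = 1 \<or> \<sigma> v = -1) \<and> (\<forall>e\<in>set G. \<not> is_loop e \<longrightarrow> pairing \<sigma> e = 0)) \<and>
    (\<exists>y. \<forall>e\<in>set G. \<not> is_loop e \<longrightarrow> pairing y e = h e)"
  using assms
proof (induction G)
  case Nil
  show ?case by (auto intro: exI[of _ "\<lambda>_. 1"])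
next
  case (Cons e G)
  obtain a b s where e: "e = (a, b, s)" by (cases e)
  have "forest G" using Cons.prems e by simp
  from Cons.IH[OF this] obtain \<sigma> y where \<sigma>: "\<And>v. \<sigma> v = 1 \<or> \<sigma> v = -1"
      "\<And>e. e \<in> set G \<Longrightarrow> \<not> is_loop e \<Longrightarrow> pairing \<sigma> e = 0"
    and y: "\<And>e. e \<in> set G \<Longrightarrow> \<not> is_loop e \<Longrightarrow> pairing y e = h e" by blast
  show ?case
  proof (cases "a = b")
    case True
    have "\<forall>d\<in>set (e # G). \<not> is_loop d \<longrightarrow> pairing \<sigma> d = 0"
      "\<forall>d\<in>set (e # G). \<not> is_loop d \<longrightarrow> pairing y d = h d"
      using \<sigma>(2) y e True by auto
    then show ?thesis using \<sigma>(1) by blast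
  next
    case False
    define C where "C = {v. (a, v) \<in> (adj G)\<^sup>*}"
    have ab: "a \<in> C" "b \<notin> C" using Cons.prems False by (auto simp: C_def e)
    have C: "i \<in> C \<longleftrightarrow> j \<in> C" if "(i, j, t) \<in> set G" for i j t
    proof -
      have "(i, j) \<in> adj G" "(j, i) \<in> adj G" using that by (force simp: adj_def)+
      then show ?thesis unfolding C_def by (auto intro: rtrancl_into_rtrancl)
    qed
    \<comment> \<open>Flipping the signs on the component of \<open>a\<close> keeps the equations of
      \<open>G\<close>, as no edge of \<open>G\<close> leaves the component. Since \<open>b\<close>
      lies outside, one of \<open>\<sigma>\<close> and \<open>\<sigma>'\<close> also solves the
      equation of \<open>e\<close>.\<close>
    define \<sigma>' where "\<sigma>' = (\<lambda>v. if v \<in> C then - \<sigma> v else \<sigma> v)"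
    have "pairing \<sigma>' d = 0" if d: "d \<in> set G" "\<not> is_loop d" for d
    proof -
      obtain i j t where d': "d = (i, j, t)" by (cases d)
      show ?thesis using \<sigma>(2)[OF d] C[of i j t] d unfolding d' \<sigma>'_def by (cases t) auto
    qed
    moreover have "pairing \<sigma> e = 0 \<or> pairing \<sigma>' e = 0"
      using \<sigma>(1)[of a] \<sigma>(1)[of b] ab unfolding e \<sigma>'_def by (cases s) auto
    moreover have "\<sigma>' v = 1 \<or> \<sigma>' v = -1" for v using \<sigma>(1)[of v] by (auto simp: \<sigma>'_def)
    ultimately have 1: "\<exists>\<sigma>. (\<forall>v. \<sigma> v = 1 \<or> \<sigma> v = -1) \<and> (\<forall>d\<in>set (e # G). \<not> is_loop d \<longrightarrow> pairing \<sigma> d = 0)"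
      using \<sigma> by (metis set_ConsD)
    \<comment> \<open>Adding a multiple of \<open>\<sigma>\<close> on the component of
      \<open>a\<close> preserves the values on the nonloop edges of \<open>G\<close>; the factor
      corrects the value on \<open>e\<close>, of which only the end \<open>a\<close> lies in the
      component.\<close>
    define y' where "y' = (\<lambda>v. if v \<in> C then y v + (h e - pairing y e) / \<sigma> a * \<sigma> v else y v)"
    have "pairing y' d = h d" if d: "d \<in> set G" "\<not> is_loop d" for d
    proof -
      obtain i j t where d': "d = (i, j, t)" by (cases d)
      define r where "r = (h e - pairing y e) / \<sigma> a"
      have "pairing y' d = (if i \<in> C then pairing y d + r * pairing \<sigma> d else pairing y d)"
        using C[of i j t] d unfolding d' y'_def r_def[symmetric] by (cases t) (auto simp: algebra_simps)
      then show ?thesis using \<sigma>(2)[OF d] y[OF d] by simp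
    qed
    moreover have "\<sigma> a \<noteq> 0" using \<sigma>(1)[of a] by auto
    then have "pairing y' e = h e" using ab unfolding e y'_def by (cases s) auto
    ultimately have 2: "\<exists>y. \<forall>d\<in>set (e # G). \<not> is_loop d \<longrightarrow> pairing y d = h d"
      by (intro exI[of _ y']) auto
    show ?thesis using 1 2 by blast
  qed
qed

lemma structured_forest: "structured n G \<Longrightarrow> forest G"
  using connected_labelling[of n G] structured_pos structured_nonloops by (auto simp: structured_def)

lemma structured_loop_unique:
  assumes "structured n G" "x \<in> set G" "y \<in> set G" "is_loop x" "is_loop y"
  shows "x = y"
proof -
  obtain z where "filter is_loop G = [z]"
    using assms(1) by (auto simp: structured_def length_Suc_conv)
  moreover have "x \<in> set (filter is_loop G)" "y \<in> set (filter is_loop G)" using assms by auto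
  ultimately show ?thesis by auto
qed

lemma structured_edge:
  assumes "structured n G" "(i, j, s) \<in> set G"
  shows "1 \<le> i" "i \<le> j" "j \<le> n" "s = Neg \<Longrightarrow> i < j"
  using assms by (auto simp: structured_def signed_graph_def signed_edges_def)

lemma structured_obtain_loop:
  assumes "structured n G"
  obtains r where "(r, r, Pos) \<in> set G" "1 \<le> r" "r \<le> n"
proof -
  obtain z where "filter is_loop G = [z]"
    using assms by (auto simp: structured_def length_Suc_conv)
  then have "z \<in> set (filter is_loop G)" by simp
  then have "z \<in> set G" "is_loop z" by auto
  from \<open>is_loop z\<close> obtain r s where "z = (r, r, s)" by (cases z) auto
  with \<open>z \<in> set G\<close> have z: "z = (r, r, s)" "(r, r, s) \<in> set G" by auto
  then show thesis using that structured_edge[OF assms z(2)] by (cases s) auto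
qed

text \<open>The tree edges leave the freedom of adding \<open>t * \<sigma> v\<close>, and the loop
  at \<open>r\<close>, on which \<open>\<sigma>\<close> has the nonzero value
  \<open>2 * \<sigma> r\<close>, fixes \<open>t\<close>. In other words, the edge vectors are
  linearly independent.\<close>

lemma structured_pairing:
  assumes "structured n G"
  shows "\<exists>y. \<forall>e\<in>set G. pairing y e = h e"
proof -
  obtain \<sigma> y where \<sigma>: "\<And>v. \<sigma> v = 1 \<or> \<sigma> v = -1"
      "\<And>e. e \<in> set G \<Longrightarrow> \<not> is_loop e \<Longrightarrow> pairing \<sigma> e = 0"
    and y: "\<And>e. e \<in> set G \<Longrightarrow> \<not> is_loop e \<Longrightarrow> pairing y e = h e"
    using forest_pairing[OF structured_forest[OF assms], of h] by blast
  obtain r where r: "(r, r, Pos) \<in> set G" using structured_obtain_loop[OF assms] by blast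
  define t where "t = (h (r, r, Pos) - 2 * y r) / (2 * \<sigma> r)"
  have "pairing (\<lambda>v. y v + t * \<sigma> v) e = h e" if e: "e \<in> set G" for e
  proof (cases "is_loop e")
    case True
    then have "e = (r, r, Pos)" using structured_loop_unique[OF assms e r] by simp
    moreover have "\<sigma> r \<noteq> 0" using \<sigma>(1)[of r] by auto
    ultimately show ?thesis by (simp add: t_def field_simps)
  next
    case False
    obtain i j s where e': "e = (i, j, s)" by (cases e)
    have "pairing (\<lambda>v. y v + t * \<sigma> v) e = pairing y e + t * pairing \<sigma> e"
      unfolding e' by (cases s) (auto simp: algebra_simps)
    then show ?thesis using \<sigma>(2)[OF e False] y[OF e False] by simp
  qed
  then show ?thesis by blast
qed

text \<open>The edge vectors span: the loop forces the value 0 at its vertex, and every edge carries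
  the zero from one end to the other.\<close>

lemma structured_pairing_zero:
  assumes "structured n G" "\<And>e. e \<in> set G \<Longrightarrow> pairing y e = 0" "k \<in> {1..n}"
  shows "y k = 0"
proof -
  obtain r where r: "(r, r, Pos) \<in> set G" "1 \<le> r" "r \<le> n" using structured_obtain_loop[OF assms(1)] by blast
  have "(r, k) \<in> (adj G)\<^sup>*" using assms(1,3) r by (auto simp: structured_def connected_graph_adj)
  then show ?thesis
  proof (induction rule: rtrancl_induct)
    case base
    show ?case using assms(2)[OF r(1)] by simp
  next
    case (step u v)
    then obtain i j s where e: "(i, j, s) \<in> set G" "{i, j} = {u, v}" by (auto simp: adj_def)
    show ?case using assms(2)[OF e(1)] step(3) e(2) by (cases s) (auto simp: doubleton_eq_iff)
  qed
qed

section \<open>Closure properties of cones\<close>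

lemma edge_coneI: "(\<And>e. e \<in> set G \<Longrightarrow> 0 \<le> c e) \<Longrightarrow> (\<lambda>k. \<Sum>e\<in>set G. c e * edge_vec e k) \<in> edge_cone G"
  unfolding edge_cone_def by blast

lemma edge_cone_add:
  assumes "x \<in> edge_cone G" "x' \<in> edge_cone G"
  shows "(\<lambda>k. x k + x' k) \<in> edge_cone G"
proof -
  from assms obtain c c' where c: "\<forall>e\<in>set G. 0 \<le> c e" "\<forall>e\<in>set G. 0 \<le> c' e"
    "x = (\<lambda>k. \<Sum>e\<in>set G. c e * edge_vec e k)" "x' = (\<lambda>k. \<Sum>e\<in>set G. c' e * edge_vec e k)"
    unfolding edge_cone_def by blast
  have "(\<lambda>k. x k + x' k) = (\<lambda>k. \<Sum>e\<in>set G. (c e + c' e) * edge_vec e k)"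
    unfolding c by (simp add: algebra_simps sum.distrib)
  also have "\<dots> \<in> edge_cone G" using c by (intro edge_coneI) auto
  finally show ?thesis .
qed

lemma edge_cone_scale:
  assumes "x \<in> edge_cone G" "0 \<le> r"
  shows "(\<lambda>k. r * x k) \<in> edge_cone G"
proof -
  from assms obtain c where c: "\<forall>e\<in>set G. 0 \<le> c e" "x = (\<lambda>k. \<Sum>e\<in>set G. c e * edge_vec e k)"
    unfolding edge_cone_def by blast
  have "(\<lambda>k. r * x k) = (\<lambda>k. \<Sum>e\<in>set G. (r * c e) * edge_vec e k)"
    unfolding c by (simp add: sum_distrib_left mult.assoc)
  also have "\<dots> \<in> edge_cone G" using c assms(2) by (intro edge_coneI) auto
  finally show ?thesis .
qed

lemma edge_cone_zero: "(\<lambda>k. 0) \<in> edge_cone G"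
  using edge_coneI[of G "\<lambda>_. 0"] by simp

lemma edge_cone_sum:
  assumes "finite A" "\<And>a. a \<in> A \<Longrightarrow> x a \<in> edge_cone G"
  shows "(\<lambda>k. \<Sum>a\<in>A. x a k) \<in> edge_cone G"
  using assms
proof (induction A rule: finite_induct)
  case (insert a A)
  then show ?case using edge_cone_add[of "x a" G "\<lambda>k. \<Sum>a\<in>A. x a k"] by simp
qed (simp add: edge_cone_zero)

lemma edge_vec_in_cone:
  assumes "e \<in> set G"
  shows "edge_vec e \<in> edge_cone G"
proof -
  have "edge_vec e = (\<lambda>k. \<Sum>d\<in>set G. (if d = e then 1 else 0) * edge_vec d k)"
    using assms by (auto simp: if_distrib[of "\<lambda>x. x * _"] cong: if_cong)
  also have "\<dots> \<in> edge_cone G" by (intro edge_coneI) auto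
  finally show ?thesis .
qed

lemma edge_cone_subset:
  assumes "\<And>e. e \<in> set H \<Longrightarrow> edge_vec e \<in> edge_cone G"
  shows "edge_cone H \<subseteq> edge_cone G"
proof
  fix x assume "x \<in> edge_cone H"
  then obtain c where c: "\<forall>e\<in>set H. 0 \<le> c e" "x = (\<lambda>k. \<Sum>e\<in>set H. c e * edge_vec e k)"
    unfolding edge_cone_def by blast
  show "x \<in> edge_cone G"
    unfolding c using c(1) assms by (intro edge_cone_sum edge_cone_scale) auto
qed

lemma edge_cone_Cons:
  assumes "x \<in> edge_cone (e # G)"
  obtains r s where "0 \<le> s" "r \<in> edge_cone G" "x = (\<lambda>k. r k + s * edge_vec e k)"
proof -
  from assms obtain c where c: "\<forall>d\<in>set (e # G). 0 \<le> c d" "x = (\<lambda>k. \<Sum>d\<in>set (e # G). c d * edge_vec d k)"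
    unfolding edge_cone_def by blast
  show thesis
  proof (cases "e \<in> set G")
    \<comment> \<open>The cone is built on the edge set, so a repeated \<open>e\<close> adds no
      summand of its own.\<close>
    case True
    then have "x \<in> edge_cone G" unfolding c using c(1) by (simp add: insert_absorb edge_coneI)
    then show thesis using that[of 0 x] by simp
  next
    case False
    then have "x = (\<lambda>k. (\<Sum>d\<in>set G. c d * edge_vec d k) + c e * edge_vec e k)"
      unfolding c by (simp add: add.commute)
    then show thesis using that[of "c e"] edge_coneI[of G c] c(1) by simp
  qed
qed

lemma edge_cone_pairing:
  assumes "x \<in> edge_cone G" "signed_graph n G" "\<And>e. e \<in> set G \<Longrightarrow> 0 \<le> pairing y e"
  shows "0 \<le> (\<Sum>k=1..n. y k * x k)"
proof -
  from assms(1) obtain c where c: "\<forall>e\<in>set G. 0 \<le> c e" "x = (\<lambda>k. \<Sum>e\<in>set G. c e * edge_vec e k)"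
    unfolding edge_cone_def by blast
  have "(\<Sum>k=1..n. y k * x k) = (\<Sum>e\<in>set G. c e * (\<Sum>k=1..n. y k * edge_vec e k))"
    unfolding c sum_distrib_left by (subst sum.swap) (simp add: algebra_simps)
  also have "\<dots> = (\<Sum>e\<in>set G. c e * pairing y e)"
    using assms(2) pairing_edge_vec[of _ n y] by (intro sum.cong refl) (simp add: signed_graph_def subsetD)
  also have "\<dots> \<ge> 0" using c(1) assms(3) by (intro sum_nonneg mult_nonneg_nonneg) auto
  finally show ?thesis .
qed

lemma edge_cone_set_cong: "set G = set H \<Longrightarrow> edge_cone G = edge_cone H"
  by (simp add: edge_cone_def)

section \<open>How the cones of the reducts divide the old cone\<close>

lemma edge_rule_cone_subset:
  assumes "edge_rule e f rs" "(e', f') \<in> set rs"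
  shows "edge_cone (U @ [e', f'] @ V) \<subseteq> edge_cone (U @ [e, f] @ V)"
proof (rule edge_cone_subset)
  let ?C = "edge_cone (U @ [e, f] @ V)"
  have ef: "edge_vec e \<in> ?C" "edge_vec f \<in> ?C" by (auto intro: edge_vec_in_cone)
  have s1: "(\<lambda>k. edge_vec e k + edge_vec f k) \<in> ?C" using edge_cone_add ef by blast
  \<comment> \<open>In the loop rule the loop at \<open>i\<close> has the vector of \<open>e\<close>
    taken twice plus that of \<open>f\<close>; every other new edge has the plain sum.\<close>
  have s2: "(\<lambda>k. edge_vec e k + (edge_vec e k + edge_vec f k)) \<in> ?C" using edge_cone_add[OF ef(1) s1] .
  fix d assume d: "d \<in> set (U @ [e', f'] @ V)"
  have "edge_vec e' \<in> ?C \<and> edge_vec f' \<in> ?C"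
    using assms(1)
  proof (cases rule: edge_rule.cases)
    case (chain_rule i j k t)
    have "edge_vec (i, k, t) = (\<lambda>k. edge_vec e k + edge_vec f k)"
      unfolding chain_rule by (cases t) auto
    then show ?thesis using assms(2) ef s1 chain_rule by auto
  next
    case (fork_rule i j k t t')
    have "edge_vec (i, j, Pos) = (\<lambda>k. edge_vec e k + edge_vec f k)"
      using fork_rule(6) unfolding fork_rule by (cases t; cases t') auto
    then show ?thesis using assms(2) ef s1 fork_rule by auto
  next
    case (loop_rule i j)
    have "edge_vec (i, j, Pos) = (\<lambda>k. edge_vec e k + edge_vec f k)"
      "edge_vec (i, i, Pos) = (\<lambda>k. edge_vec e k + (edge_vec e k + edge_vec f k))"
      unfolding loop_rule by auto
    then show ?thesis using assms(2) ef s1 s2 loop_rule by auto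
  qed
  then show "edge_vec d \<in> ?C" using d by (auto intro: edge_vec_in_cone)
qed

text \<open>Each new edge is a ray in the plane cone spanned by \<open>e\<close> and
  \<open>f\<close>. The part that contains \<open>x\<close> is read off the coefficients
  \<open>s\<close> of \<open>e\<close> and \<open>t\<close> of \<open>f\<close>; the contribution
  \<open>r\<close> of the other edges is untouched.\<close>

lemma edge_rule_cone_cover:
  assumes "edge_rule e f rs" "x \<in> edge_cone (U @ [e, f] @ V)"
  shows "\<exists>(e', f')\<in>set rs. x \<in> edge_cone (U @ [e', f'] @ V)"
proof -
  have "x \<in> edge_cone (e # f # U @ V)"
    using assms(2) edge_cone_set_cong[of "U @ [e, f] @ V" "e # f # U @ V"] by auto
  then obtain r' s where r': "0 \<le> s" "r' \<in> edge_cone (f # U @ V)" "x = (\<lambda>k. r' k + s * edge_vec e k)"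
    by (rule edge_cone_Cons)
  from r'(2) obtain r t where r: "0 \<le> t" "r \<in> edge_cone (U @ V)" "r' = (\<lambda>k. r k + t * edge_vec f k)"
    by (rule edge_cone_Cons)
  have x: "x = (\<lambda>k. r k + t * edge_vec f k + s * edge_vec e k)" unfolding r' r by simp
  have comb: "x \<in> edge_cone (U @ [e', f'] @ V)"
    if "0 \<le> a" "0 \<le> b" "\<And>k. t * edge_vec f k + s * edge_vec e k = a * edge_vec e' k + b * edge_vec f' k"
    for a b e' f'
  proof -
    let ?C = "edge_cone (U @ [e', f'] @ V)"
    have "edge_cone (U @ V) \<subseteq> ?C" by (rule edge_cone_subset) (auto intro: edge_vec_in_cone)
    then have "r \<in> ?C" using r(2) by auto
    moreover have "(\<lambda>k. a * edge_vec e' k + b * edge_vec f' k) \<in> ?C"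
      using that(1,2) by (intro edge_cone_add edge_cone_scale edge_vec_in_cone) auto
    ultimately have "(\<lambda>k. r k + (a * edge_vec e' k + b * edge_vec f' k)) \<in> ?C" by (rule edge_cone_add)
    then show ?thesis unfolding x using that(3) by (simp add: add.assoc)
  qed
  show ?thesis
    using assms(1)
  proof (cases rule: edge_rule.cases)
    case (chain_rule i j k u)
    have g: "edge_vec (i, k, u) l = edge_vec e l + edge_vec f l" for l
      unfolding chain_rule by (cases u) auto
    show ?thesis
    proof (cases "t \<le> s")
      case True
      have "x \<in> edge_cone (U @ [(i, k, u), (i, j, Neg)] @ V)"
        by (rule comb[of t "s - t"]) (use True r(1) g chain_rule(1,2) in \<open>auto simp del: edge_vec.simps simp: algebra_simps\<close>)
      then show ?thesis using chain_rule by auto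
    next
      case False
      have "x \<in> edge_cone (U @ [(j, k, u), (i, k, u)] @ V)"
        by (rule comb[of "t - s" s]) (use False r'(1) g chain_rule(1,2) in \<open>auto simp del: edge_vec.simps simp: algebra_simps\<close>)
      then show ?thesis using chain_rule by auto
    qed
  next
    case (fork_rule i j k u u')
    have g: "edge_vec (i, j, Pos) l = edge_vec e l + edge_vec f l" for l
      using fork_rule(6) unfolding fork_rule by (cases u; cases u') auto
    show ?thesis
    proof (cases "t \<le> s")
      case True
      have "x \<in> edge_cone (U @ [(i, j, Pos), (j, k, u)] @ V)"
        by (rule comb[of t "s - t"]) (use True r(1) g fork_rule(1,2) in \<open>auto simp del: edge_vec.simps simp: algebra_simps\<close>)
      then show ?thesis using fork_rule by auto
    next
      case False
      have "x \<in> edge_cone (U @ [(i, k, u'), (i, j, Pos)] @ V)"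
        by (rule comb[of "t - s" s]) (use False r'(1) g fork_rule(1,2) in \<open>auto simp del: edge_vec.simps simp: algebra_simps\<close>)
      then show ?thesis using fork_rule by auto
    qed
  next
    case (loop_rule i j)
    have g: "edge_vec (i, j, Pos) l = edge_vec e l + edge_vec f l"
      "edge_vec (i, i, Pos) l = 2 * edge_vec e l + edge_vec f l" for l
      unfolding loop_rule by auto
    \<comment> \<open>The rays of the loop at \<open>i\<close> and of \<open>(i, j, Pos)\<close>
      have the ratios 2 : 1 and 1 : 1 of \<open>s\<close> to \<open>t\<close>.\<close>
    consider "2 * t \<le> s" | "t \<le> s" "s \<le> 2 * t" | "s \<le> t" by linarith
    then show ?thesis
    proof cases
      case 1
      have "x \<in> edge_cone (U @ [(i, i, Pos), (i, j, Neg)] @ V)"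
        by (rule comb[of t "s - 2 * t"])
          (use 1 r(1) g(2) loop_rule(1,2) in \<open>auto simp del: edge_vec.simps simp: algebra_simps\<close>)
      then show ?thesis using loop_rule by auto
    next
      case 2
      have "x \<in> edge_cone (U @ [(i, j, Pos), (i, i, Pos)] @ V)"
        by (rule comb[of "2 * t - s" "s - t"])
          (use 2 r(1) g loop_rule(1,2) in \<open>auto simp del: edge_vec.simps simp: algebra_simps\<close>)
      then show ?thesis using loop_rule by auto
    next
      case 3
      have "x \<in> edge_cone (U @ [(j, j, Pos), (i, j, Pos)] @ V)"
        by (rule comb[of "t - s" s])
          (use 3 r'(1) g loop_rule(1,2) in \<open>auto simp del: edge_vec.simps simp: algebra_simps\<close>)
      then show ?thesis using loop_rule by auto
    qed
  qed
qed

text \<open>The functional vanishes on a ray between the two plane cones: for \<open>q = -1\<close>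
  on the sum of the vectors of \<open>e\<close> and \<open>f\<close>, for \<open>q = -2\<close> on
  the new loop.\<close>

lemma edge_rule_separate:
  assumes "edge_rule e f rs" "a < b" "b < length rs" "rs ! a = (e1, f1)" "rs ! b = (e2, f2)"
  shows "\<exists>q. \<forall>y. pairing y e = 1 \<and> pairing y f = q \<longrightarrow>
    0 \<le> pairing y e1 \<and> 0 \<le> pairing y f1 \<and> pairing y e2 \<le> 0 \<and> pairing y f2 \<le> 0"
  using assms(1)
proof (cases rule: edge_rule.cases)
  case (chain_rule i j k t)
  then have "a = 0" "b = 1" using assms(2,3) by auto
  then show ?thesis using chain_rule assms(4,5) by (intro exI[of _ "-1"]) (cases t; auto)
next
  case (fork_rule i j k t t')
  then have "a = 0" "b = 1" using assms(2,3) by auto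
  then show ?thesis using fork_rule assms(4,5) by (intro exI[of _ "-1"]) (cases t; cases t'; auto)
next
  case (loop_rule i j)
  then have "a = 0 \<and> b = 1 \<or> a = 0 \<and> b = 2 \<or> a = 1 \<and> b = 2" using assms(2,3) by auto
  then show ?thesis
  proof (elim disjE)
    assume "a = 0 \<and> b = 1"
    then show ?thesis using loop_rule assms(4,5) by (intro exI[of _ "-2"]) auto
  next
    assume "a = 0 \<and> b = 2"
    then show ?thesis using loop_rule assms(4,5) by (intro exI[of _ "-1"]) auto
  next
    assume "a = 1 \<and> b = 2"
    then show ?thesis using loop_rule assms(4,5) by (intro exI[of _ "-1"]) auto
  qed
qed

text \<open>By linear independence there is a functional with the separating values on
  \<open>e\<close> and \<open>f\<close> that vanishes on all other edges. It has both signs on every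
  edge of \<open>G\<close>, hence is zero on them; as these span, it is zero, although its value at
  \<open>e\<close> is 1.\<close>

lemma edge_rule_closure_disjoint:
  assumes "structured n (U @ [e, f] @ V)" "edge_rule e f rs" "a < b" "b < length rs"
    and "rs ! a = (e1, f1)" "rs ! b = (e2, f2)"
    and "structured n G" "set G \<subseteq> trans_closure n (U @ [e1, f1] @ V)"
    and "set G \<subseteq> trans_closure n (U @ [e2, f2] @ V)"
  shows False
proof -
  obtain q where q: "\<And>y. pairing y e = 1 \<Longrightarrow> pairing y f = q \<Longrightarrow>
    0 \<le> pairing y e1 \<and> 0 \<le> pairing y f1 \<and> pairing y e2 \<le> 0 \<and> pairing y f2 \<le> 0"
    using edge_rule_separate[OF assms(2-6)] by blast
  have dist: "e \<noteq> f" "e \<notin> set U \<union> set V" "f \<notin> set U \<union> set V"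
    using structured_distinct[OF assms(1)] by auto
  obtain y where y: "\<And>d. d \<in> set (U @ [e, f] @ V) \<Longrightarrow>
      pairing y d = (if d = e then 1 else if d = f then q else 0)"
    using structured_pairing[OF assms(1), of "\<lambda>d. if d = e then 1 else if d = f then q else 0"] by blast
  have ye: "pairing y e = 1" "pairing y f = q" using y dist by auto
  have y0: "pairing y d = 0" if "d \<in> set U \<union> set V" for d using y[of d] that dist by auto
  have mem: "(e1, f1) \<in> set rs" "(e2, f2) \<in> set rs" using assms(3-6) by (metis nth_mem order_less_trans)+
  have sg: "signed_graph n (U @ [e1, f1] @ V)" "signed_graph n (U @ [e2, f2] @ V)"
    using assms(1) edge_rule_signed[OF assms(2) mem(1)] edge_rule_signed[OF assms(2) mem(2)]
    by (auto simp: structured_def signed_graph_def)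
  have neg: "pairing (\<lambda>k. - y k) d = - pairing y d" for d
    by (cases "(\<lambda>k. - y k, d)" rule: pairing.cases) auto
  have "pairing y d = 0" if d: "d \<in> set G" for d
  proof -
    have ds: "d \<in> signed_edges n" and c: "edge_vec d \<in> edge_cone (U @ [e1, f1] @ V)"
      "edge_vec d \<in> edge_cone (U @ [e2, f2] @ V)"
      using d assms(8,9) by (auto simp: trans_closure_def)
    have "0 \<le> (\<Sum>k=1..n. y k * edge_vec d k)"
      by (rule edge_cone_pairing[OF c(1) sg(1)]) (use q[OF ye] y0 in auto)
    moreover have "0 \<le> (\<Sum>k=1..n. - y k * edge_vec d k)"
      by (rule edge_cone_pairing[OF c(2) sg(2)]) (use q[OF ye] y0 neg in auto)
    ultimately show ?thesis using pairing_edge_vec[OF ds, of y] by (simp add: sum_negf)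
  qed
  then have "y k = 0" if "k \<in> {1..n}" for k using structured_pairing_zero[OF assms(7)] that by blast
  moreover obtain i j s where e: "e = (i, j, s)" by (cases e)
  then have "i \<in> {1..n}" "j \<in> {1..n}" using structured_edge[OF assms(1), of i j s] by auto
  ultimately show False using ye(1) e by (cases s) auto
qed

section \<open>Alternating graphs are determined by a point of their cone\<close>

definition sign_vertices :: "sign \<Rightarrow> edge set \<Rightarrow> nat set" where
  "sign_vertices s A = {k. \<exists>e\<in>A. k \<in> endpoints e \<and> incidence_sign e k = s}"

definition sign_coherent :: "edge set \<Rightarrow> bool" where
  "sign_coherent A \<longleftrightarrow> (\<forall>e\<in>A. \<forall>f\<in>A. \<forall>v. v \<in> endpoints e \<and> v \<in> endpoints f \<longrightarrow>
     incidence_sign e v = incidence_sign f v)"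

text \<open>
  An edge that every admissible graph with positive vertices \<open>P\<close> and negative vertices \<open>N\<close> must
  contain: the vertices strictly below a negative edge can only be joined by negative edges.
\<close>

definition corner_edge :: "nat set \<Rightarrow> nat set \<Rightarrow> edge" where
  "corner_edge P N = (if N = {} then (Min P, Max P, Pos) else (Max {k \<in> P. k < Min N}, Min N, Neg))"

text \<open>Let \<open>j\<close> be the least negative vertex and \<open>(i, j, Neg)\<close> an edge
  ending there. If i < k < j, an edge that is positive at \<open>k\<close> must be
  \<open>(k, j, Neg)\<close>: a negative one cannot end before \<open>j\<close> and crosses
  \<open>(i, j, Neg)\<close> if it ends later, and a positive one lies under that edge or crosses
  it. If all edges are positive, distinct edges at the least and at the greatest vertex would
  violate (i), (ii) or (iii), or both be loops.\<close>

lemma corner_edge_mem: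
  assumes A: "finite A" "A \<noteq> {}" "A \<subseteq> signed_edges n"
    and nc: "\<And>x y. x \<in> A \<Longrightarrow> y \<in> A \<Longrightarrow> \<not> conflict x y"
    and loops: "\<And>x y. x \<in> A \<Longrightarrow> y \<in> A \<Longrightarrow> is_loop x \<Longrightarrow> is_loop y \<Longrightarrow> x = y"
  shows "corner_edge (sign_vertices Pos A) (sign_vertices Neg A) \<in> A"
proof -
  let ?P = "sign_vertices Pos A" and ?N = "sign_vertices Neg A"
  have edge: "i \<le> j" "s = Neg \<Longrightarrow> i < j" if "(i, j, s) \<in> A" for i j s
    using that A(3) by (auto simp: signed_edges_def)
  have left: "i \<in> ?P" if "(i, j, s) \<in> A" for i j s
    using that by (cases s) (force simp: sign_vertices_def)+
  have right: "j \<in> sign_vertices s A" if "(i, j, s) \<in> A" for i j s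
    using that edge(2)[OF that] by (cases s) (force simp: sign_vertices_def)+
  have "sign_vertices s A \<subseteq> \<Union> (endpoints ` A)" for s by (auto simp: sign_vertices_def)
  moreover have "finite (\<Union> (endpoints ` A))" using A(1) by (auto split: prod.splits)
  ultimately have fin: "finite (sign_vertices s A)" for s by (rule finite_subset)
  show ?thesis
  proof (cases "?N = {}")
    case False
    define j where "j = Min ?N"
    have jN: "j \<in> ?N" and jmin: "\<And>l. l \<in> ?N \<Longrightarrow> j \<le> l" using False fin by (auto simp: j_def)
    from jN obtain i where e: "(i, j, Neg) \<in> A" 
    proof -
      from jN obtain a b s where "(a, b, s) \<in> A" "j \<in> {a, b}" "incidence_sign (a, b, s) j = Neg"
        by (auto simp: sign_vertices_def)
      then show thesis using that by (cases s) (auto split: if_splits)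
    qed
    define k where "k = Max {k \<in> ?P. k < j}"
    have K: "finite {k \<in> ?P. k < j}" "i \<in> {k \<in> ?P. k < j}" using fin left[OF e] edge(2)[OF e] by auto
    then have "k \<in> {k \<in> ?P. k < j}" unfolding k_def by (intro Max_in) auto
    then have k: "k \<in> ?P" "k < j" by auto
    have ik: "i \<le> k" using K unfolding k_def by (intro Max_ge)
    have "(k, j, Neg) \<in> A"
    proof (cases "i = k")
      case True
      then show ?thesis using e by simp
    next
      case False
      then have ik: "i < k" using ik by simp
      from k(1) obtain a b t where f: "(a, b, t) \<in> A" "k \<in> {a, b}" "incidence_sign (a, b, t) k = Pos"
        by (auto simp: sign_vertices_def)
      show ?thesis
      proof (cases t)
        case Neg
        then have "k = a" using f by (auto split: if_splits)
        moreover have "j \<le> b" using jmin right f(1) Neg by blast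
        ultimately show ?thesis using nc[OF e f(1)] f(1) ik k(2) Neg by (cases "b = j") auto
      next
        case Pos
        then show ?thesis using nc[OF e f(1)] nc[OF f(1) e] f(2) ik k(2) edge(1)[OF f(1)]
          by (cases "a = b") (auto simp: not_le not_less)
      qed
    qed
    then show ?thesis using False unfolding corner_edge_def k_def j_def by simp
  next
    case True
    have pos: "s = Pos" if "(a, b, s) \<in> A" for a b s
      using right[OF that] True by (cases s) auto
    obtain a0 b0 s0 where "(a0, b0, s0) \<in> A" using A(2) by auto
    then have ne: "?P \<noteq> {}" using left by blast
    define i j where "i = Min ?P" and "j = Max ?P"
    have iP: "i \<in> ?P" "\<And>l. l \<in> ?P \<Longrightarrow> i \<le> l" and jP: "j \<in> ?P" "\<And>l. l \<in> ?P \<Longrightarrow> l \<le> j"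
      using ne fin by (auto simp: i_def j_def)
    obtain b where e: "(i, b, Pos) \<in> A"
    proof -
      from iP(1) obtain a b s where f: "(a, b, s) \<in> A" "i \<in> {a, b}" by (auto simp: sign_vertices_def)
      moreover have "i \<le> a" "s = Pos" "a \<le> b" using iP(2)[OF left] f pos edge by auto
      ultimately show thesis using that by (cases "i = a") auto
    qed
    obtain c where f: "(c, j, Pos) \<in> A"
    proof -
      from jP(1) obtain a b s where f: "(a, b, s) \<in> A" "j \<in> {a, b}" by (auto simp: sign_vertices_def)
      moreover have "s = Pos" using f pos by auto
      moreover have "b \<le> j" "a \<le> b" using jP(2)[of b] right[OF f(1)] \<open>s = Pos\<close> edge f by auto
      ultimately show thesis using that by (cases "j = b") auto
    qed
    have le: "b \<le> j" "i \<le> c" "i \<le> b" "c \<le> j" using jP(2)[OF right[OF e]] iP(2)[OF left[OF f]] edge e f by auto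
    have "(i, j, Pos) \<in> A"
    proof (rule ccontr)
      assume no: "(i, j, Pos) \<notin> A"
      then have "b < j" "i < c" using e f le by (metis order_le_less)+
      then show False
        using nc[OF e f] nc[OF f e] loops[OF e f] le by (cases "b = i"; cases "c = j") auto
    qed
    then show ?thesis using True unfolding corner_edge_def i_def j_def by simp
  qed
qed

lemma edge_vec_sign:
  assumes "e \<in> signed_edges n"
  shows "edge_vec e k > 0 \<longleftrightarrow> k \<in> endpoints e \<and> incidence_sign e k = Pos"
    and "edge_vec e k < 0 \<longleftrightarrow> k \<in> endpoints e \<and> incidence_sign e k = Neg"
  using assms by (cases "(e, k)" rule: incidence_sign.cases; auto simp: signed_edges_def unit_vec_def)+

text \<open>By coherence the terms at a vertex never have opposite signs, so nothing cancels. Hence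
  the sign vertices depend only on the point and not on the combination that represents it.\<close>

lemma sign_vertices_positive_sum:
  assumes A: "finite A" "A \<subseteq> signed_edges n" "sign_coherent A" and a: "\<And>e. e \<in> A \<Longrightarrow> 0 < a e"
  shows "sign_vertices Pos A = {k. 0 < (\<Sum>e\<in>A. a e * edge_vec e k)}"
    and "sign_vertices Neg A = {k. (\<Sum>e\<in>A. a e * edge_vec e k) < 0}"
proof -
  let ?x = "\<lambda>k. \<Sum>e\<in>A. a e * edge_vec e k"
  have sg: "e \<in> signed_edges n" if "e \<in> A" for e using A(2) that by auto
  have p: "0 < ?x k" if k: "k \<in> sign_vertices Pos A" for k
  proof -
    obtain e where e: "e \<in> A" "k \<in> endpoints e" "incidence_sign e k = Pos"
      using k by (auto simp: sign_vertices_def)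
    have "0 \<le> edge_vec f k" if "f \<in> A" for f
    proof (rule ccontr)
      assume "\<not> 0 \<le> edge_vec f k"
      then have "k \<in> endpoints f \<and> incidence_sign f k = Neg"
        using edge_vec_sign(2)[OF sg[OF that], of k] by linarith
      then show False using A(3) e that unfolding sign_coherent_def by (metis sign.distinct(1))
    qed
    then have "0 \<le> a f * edge_vec f k" if "f \<in> A" for f
      using a[OF that] that by (intro mult_nonneg_nonneg) (auto simp: less_imp_le)
    moreover have "0 < a e * edge_vec e k" using e a edge_vec_sign(1)[OF sg, of e k] by simp
    ultimately show ?thesis
      using A(1) e(1) by (intro sum_pos2[of A e]) auto
  qed
  have q: "?x k < 0" if k: "k \<in> sign_vertices Neg A" for k
  proof -
    obtain e where e: "e \<in> A" "k \<in> endpoints e" "incidence_sign e k = Neg"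
      using k by (auto simp: sign_vertices_def)
    have "edge_vec f k \<le> 0" if "f \<in> A" for f
    proof (rule ccontr)
      assume "\<not> edge_vec f k \<le> 0"
      then have "k \<in> endpoints f \<and> incidence_sign f k = Pos"
        using edge_vec_sign(1)[OF sg[OF that], of k] by linarith
      then show False using A(3) e that unfolding sign_coherent_def by (metis sign.distinct(1))
    qed
    then have "0 \<le> a f * (- edge_vec f k)" if "f \<in> A" for f
      using a[OF that] that by (intro mult_nonneg_nonneg) (auto simp: less_imp_le)
    moreover have "0 < a e * (- edge_vec e k)"
      using e a edge_vec_sign(2)[OF sg, of e k] by (intro mult_pos_pos) auto
    ultimately have "0 < (\<Sum>e\<in>A. a e * (- edge_vec e k))"
      using A(1) e(1) by (intro sum_pos2[of A e]) auto
    then show ?thesis by (simp add: sum_negf)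
  qed
  have zero: "?x k = 0" if "k \<notin> sign_vertices Pos A" "k \<notin> sign_vertices Neg A" for k
  proof (rule sum.neutral, rule ballI)
    fix e assume "e \<in> A"
    then have "k \<notin> endpoints e" using that by (cases "incidence_sign e k") (auto simp: sign_vertices_def)
    then have "edge_vec e k = 0" using edge_vec_sign[OF sg[OF \<open>e \<in> A\<close>], of k] by linarith
    then show "a e * edge_vec e k = 0" by simp
  qed
  have trichotomy: "(P \<longleftrightarrow> 0 < r) \<and> (N \<longleftrightarrow> r < 0)"
    if "P \<Longrightarrow> 0 < r" "N \<Longrightarrow> r < 0" "\<not> P \<Longrightarrow> \<not> N \<Longrightarrow> r = 0" for P N and r :: real
    using that by (cases P; cases N) auto
  have "(k \<in> sign_vertices Pos A \<longleftrightarrow> 0 < ?x k) \<and> (k \<in> sign_vertices Neg A \<longleftrightarrow> ?x k < 0)" for k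
    using p q zero by (rule trichotomy)
  then show "sign_vertices Pos A = {k. 0 < ?x k}" "sign_vertices Neg A = {k. ?x k < 0}"
    by (simp_all add: set_eq_iff)
qed

text \<open>Every edge is positive at its smaller end.\<close>

lemma sign_vertices_empty:
  assumes "A \<subseteq> signed_edges n" "sign_vertices Pos A = {}"
  shows "A = {}"
proof (rule ccontr)
  assume "A \<noteq> {}"
  then obtain i j s where "(i, j, s) \<in> A" by auto
  then have "i \<in> sign_vertices Pos A" by (cases s) (force simp: sign_vertices_def)+
  then show False using assms(2) by simp
qed

lemma alternating_sign_coherent:
  assumes "structured n G" "alternating n G"
  shows "sign_coherent (set G)"
  unfolding sign_coherent_def
proof (intro ballI allI impI; elim conjE)
  fix e f v assume "e \<in> set G" "f \<in> set G" "v \<in> endpoints e" "v \<in> endpoints f"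
  moreover have "v \<in> {1..n}"
    using calculation assms(1) signed_graph_endpoints[of n G e] by (auto simp: structured_def)
  ultimately show "incidence_sign e v = incidence_sign f v"
    using assms(2) unfolding alternating_def by blast
qed

text \<open>The difference of the two representations of the point has a positive part, supported on
  \<open>A\<close> inside \<open>G\<close>, and a negative part, supported on \<open>B\<close>
  inside \<open>T\<close>. Both parts yield the same point, so their sign vertices and therefore
  their corner edges agree; but \<open>A\<close> and \<open>B\<close> are disjoint, so
  \<open>A\<close> is empty.\<close>

lemma alternating_sum_in_cone_unique:
  assumes G: "structured n G" "alternating n G" and T: "structured n T" "alternating n T"
    and sum_in: "(\<lambda>k. \<Sum>e\<in>set G. edge_vec e k) \<in> edge_cone T"
  shows "set G = set T"
proof -
  from sum_in obtain c where c: "\<forall>e\<in>set T. 0 \<le> c e"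
    "(\<lambda>k. \<Sum>e\<in>set G. edge_vec e k) = (\<lambda>k. \<Sum>e\<in>set T. c e * edge_vec e k)"
    unfolding edge_cone_def by blast
  define d where "d = (\<lambda>e. (if e \<in> set G then 1 else 0) - (if e \<in> set T then c e else 0))"
  define A where "A = {e \<in> set G \<union> set T. 0 < d e}"
  define B where "B = {e \<in> set G \<union> set T. d e < 0}"
  have AG: "A \<subseteq> set G" and BT: "B \<subseteq> set T"
    using c(1) by (auto simp: A_def B_def d_def split: if_splits)
  have fin: "finite A" "finite B" by (auto simp: A_def B_def)
  have sum: "(\<Sum>e\<in>A. d e * edge_vec e k) = (\<Sum>e\<in>B. (- d e) * edge_vec e k)" for k
  proof -
    have "(\<Sum>e\<in>set G \<union> set T. d e * edge_vec e k) =
        (\<Sum>e\<in>set G \<union> set T. (if e \<in> set G then edge_vec e k else 0)) -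
        (\<Sum>e\<in>set G \<union> set T. (if e \<in> set T then c e * edge_vec e k else 0))"
      unfolding d_def sum_subtractf[symmetric] by (intro sum.cong) (auto simp: algebra_simps)
    also have "\<dots> = (\<Sum>e\<in>set G. edge_vec e k) - (\<Sum>e\<in>set T. c e * edge_vec e k)"
      by (simp add: sum.If_cases Int_absorb1)
    also have "\<dots> = 0" using fun_cong[OF c(2), of k] by simp
    finally have "0 = (\<Sum>e\<in>set G \<union> set T. d e * edge_vec e k)" by simp
    also have "\<dots> = (\<Sum>e\<in>A \<union> B. d e * edge_vec e k)"
      by (rule sum.mono_neutral_right) (auto simp: A_def B_def)
    also have "\<dots> = (\<Sum>e\<in>A. d e * edge_vec e k) + (\<Sum>e\<in>B. d e * edge_vec e k)"
      using fin by (intro sum.union_disjoint) (auto simp: A_def B_def)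
    finally show ?thesis by (simp add: sum_negf)
  qed
  have sg: "A \<subseteq> signed_edges n" "B \<subseteq> signed_edges n"
    using AG BT G(1) T(1) by (auto simp: structured_def signed_graph_def)
  have coh: "sign_coherent A" "sign_coherent B"
    using alternating_sign_coherent[OF G] alternating_sign_coherent[OF T] AG BT
    unfolding sign_coherent_def by blast+
  have eq: "sign_vertices Pos A = sign_vertices Pos B" "sign_vertices Neg A = sign_vertices Neg B"
    using sign_vertices_positive_sum[OF fin(1) sg(1) coh(1), of d]
      sign_vertices_positive_sum[OF fin(2) sg(2) coh(2), of "\<lambda>e. - d e"] sum
    by (auto simp: A_def B_def)
  have "A = {}"
  proof (rule ccontr)
    assume ne: "A \<noteq> {}"
    then have ne': "B \<noteq> {}"
      using eq sign_vertices_empty[OF sg(1)] by (auto simp: sign_vertices_def)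
    have "corner_edge (sign_vertices Pos A) (sign_vertices Neg A) \<in> A"
    proof (rule corner_edge_mem[OF fin(1) ne sg(1)])
      fix x y assume "x \<in> A" "y \<in> A"
      then have xy: "x \<in> set G" "y \<in> set G" using AG by auto
      show "\<not> conflict x y" using xy G(1) unfolding structured_def by blast
      show "x = y" if "is_loop x" "is_loop y" using structured_loop_unique[OF G(1) xy that] .
    qed
    moreover have "corner_edge (sign_vertices Pos B) (sign_vertices Neg B) \<in> B"
    proof (rule corner_edge_mem[OF fin(2) ne' sg(2)])
      fix x y assume "x \<in> B" "y \<in> B"
      then have xy: "x \<in> set T" "y \<in> set T" using BT by auto
      show "\<not> conflict x y" using xy T(1) unfolding structured_def by blast
      show "x = y" if "is_loop x" "is_loop y" using structured_loop_unique[OF T(1) xy that] .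
    qed
    ultimately show False using eq by (auto simp: A_def B_def)
  qed
  \<comment> \<open>An edge of \<open>G\<close> has coefficient 1 there; with no positive difference
    left, its coefficient in \<open>T\<close> is at least 1. Equal numbers of edges do the
    rest.\<close>
  have "set G \<subseteq> set T"
  proof
    fix e assume e: "e \<in> set G"
    then have "\<not> 0 < d e" using \<open>A = {}\<close> unfolding A_def by blast
    then show "e \<in> set T" using e by (auto simp: d_def split: if_splits)
  qed
  moreover have "card (set G) = card (set T)"
    using structured_distinct[OF G(1)] structured_distinct[OF T(1)] G(1) T(1)
    by (simp add: distinct_card structured_def)
  ultimately show ?thesis by (intro card_subset_eq) auto
qed

lemma closure_sum_in_cone:
  "set G \<subseteq> trans_closure n T \<Longrightarrow> (\<lambda>k. \<Sum>e\<in>set G. edge_vec e k) \<in> edge_cone T"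
  by (intro edge_cone_sum) (auto simp: trans_closure_def)

lemma alternating_in_closure_unique:
  assumes "structured n G" "alternating n G" "structured n T" "alternating n T"
    and "set G \<subseteq> trans_closure n T"
  shows "set G = set T"
  using alternating_sum_in_cone_unique[OF assms(1-4)] closure_sum_in_cone[OF assms(5)] .

section \<open>Reduced forms\<close>

definition admissible :: "nat \<Rightarrow> lgraph \<Rightarrow> lgraph set" where
  "admissible n T = {G. spanning_graph_of_closure n T G \<and> alternating n G \<and> well_structured n G
     \<and> lexicographic_labels G}"

lemma lexicographic_labels_iff: "lexicographic_labels G \<longleftrightarrow> sorted (map edge_key G)"
proof -
  have "lexicographic_labels G \<longleftrightarrow>
      (\<forall>p<length G. \<forall>q<length G. edge_key (G ! p) < edge_key (G ! q) \<longrightarrow> p < q)" (is "_ \<longleftrightarrow> ?S")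
  proof
    assume L: "lexicographic_labels G"
    show ?S
    proof (intro allI impI)
      fix p q assume "p < length G" "q < length G" "edge_key (G ! p) < edge_key (G ! q)"
      then show "p < q"
        using L[unfolded lexicographic_labels_def, rule_format, of "G ! p" "Suc p" "G ! q" "Suc q"]
        by (simp add: labeled_edge_def edge_less_iff_key)
    qed
  next
    assume S: ?S
    show "lexicographic_labels G"
      unfolding lexicographic_labels_def
    proof (intro allI impI; elim conjE)
      fix e f a b assume L: "labeled_edge G e a" "labeled_edge G f b" "edge_less e f"
      then have "a - 1 < b - 1"
        using S[rule_format, of "a - 1" "b - 1"] by (auto simp: labeled_edge_def edge_less_iff_key)
      then show "a < b" by simp
    qed
  qed
  also have "\<dots> \<longleftrightarrow> sorted (map edge_key G)"
  proof
    assume S: ?S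
    have "edge_key (G ! p) \<le> edge_key (G ! q)" if "p \<le> q" "q < length G" for p q
      using S[rule_format, of q p] that by (meson leD not_le order_le_less_trans)
    then show "sorted (map edge_key G)" by (simp add: sorted_iff_nth_mono)
  next
    assume S: "sorted (map edge_key G)"
    show ?S
    proof (intro allI impI, rule ccontr)
      fix p q assume pq: "p < length G" "q < length G" "edge_key (G ! p) < edge_key (G ! q)" "\<not> p < q"
      then have "edge_key (G ! q) \<le> edge_key (G ! p)"
        using sorted_nth_mono[OF S, of q p] by simp
      then show False using pq(3) by simp
    qed
  qed
  finally show ?thesis .
qed

lemma admissible_iff:
  "G \<in> admissible n T \<longleftrightarrow> structured n G \<and> alternating n G \<and> set G \<subseteq> trans_closure n T \<and>
     sorted (map edge_key G)"
proof -
  have "signed_graph n G" if "structured n G" using that by (simp add: structured_def)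
  then show ?thesis
    unfolding admissible_def spanning_graph_of_closure_def lexicographic_labels_iff
    using well_structured_iff by blast
qed

text \<open>Over an infinite index set the sum in the theorem would be 0 by convention.\<close>

lemma finite_admissible: "finite (admissible n T)"
proof (rule finite_subset)
  have "UNIV = {Pos, Neg}" using sign.exhaust by auto
  then have "signed_edges n \<subseteq> {0..n} \<times> {0..n} \<times> {Pos, Neg}"
    by (auto simp: signed_edges_def)
  then have "finite (signed_edges n)" by (rule finite_subset) simp
  then show "finite {G. set G \<subseteq> signed_edges n \<and> length G = n}" by (rule finite_lists_length_eq)
  show "admissible n T \<subseteq> {G. set G \<subseteq> signed_edges n \<and> length G = n}"
    by (auto simp: admissible_iff structured_def signed_graph_def)
qed

lemma admissible_mono: "edge_cone S \<subseteq> edge_cone T \<Longrightarrow> admissible n S \<subseteq> admissible n T"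
  by (fastforce simp: admissible_iff trans_closure_def)

lemma structured_sort: "structured n G \<Longrightarrow> structured n (sort_key edge_key G)"
proof -
  assume st: "structured n G"
  have "adj (sort_key edge_key G) = adj G" by (simp add: adj_def)
  moreover have "length (filter is_loop (sort_key edge_key G)) = length (filter is_loop G)"
    by (simp add: filter_sort)
  ultimately show ?thesis
    using st by (simp add: structured_def signed_graph_def connected_graph_adj)
qed

text \<open>Uniqueness in the closure fixes the edge set, and injectivity of \<open>edge_key\<close>
  then fixes the order.\<close>

lemma admissible_alternating:
  assumes "structured n G" "alternating n G"
  shows "admissible n G = {sort_key edge_key G}"
proof
  have "alternating n (sort_key edge_key G)" using assms(2) unfolding alternating_def set_sort .
  moreover have "set G \<subseteq> signed_edges n"
    using assms(1) unfolding structured_def signed_graph_def by blast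
  then have "set G \<subseteq> trans_closure n G"
    using edge_vec_in_cone[of _ G] by (simp add: trans_closure_def subset_iff)
  ultimately show "{sort_key edge_key G} \<subseteq> admissible n G"
    using structured_sort[OF assms(1)] by (simp add: admissible_iff)
  show "admissible n G \<subseteq> {sort_key edge_key G}"
  proof
    fix H assume H: "H \<in> admissible n G"
    then have st: "structured n H" and so: "sorted (map edge_key H)" by (auto simp: admissible_iff)
    have "set H = set G"
      using H alternating_in_closure_unique[OF _ _ assms] by (auto simp: admissible_iff)
    moreover have "inj_on edge_key S" for S using inj_edge_key by (rule inj_on_subset) simp
    ultimately have "H = sort_key edge_key G"
      using structured_distinct[OF st] structured_distinct[OF assms(1)] so
      by (intro map_sorted_distinct_set_unique[of edge_key]) (auto simp: distinct_map)
    then show "H \<in> {sort_key edge_key G}" by simp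
  qed
qed

text \<open>Two edges with a common vertex in the wrong lexicographic order would, by
  \<open>alternating_key_prec\<close>, also be in the wrong order for the well-labeling.\<close>

lemma good_alternating_sort:
  assumes "good n G" "alternating n G"
  shows "comm_equiv (graph_monomial (sort_key edge_key G)) (graph_monomial G)"
proof (rule comm_equiv_sort)
  have st: "structured n G" and so: "sorted_wrt (\<lambda>x y. \<not> prec y x) G"
    using assms(1) by (auto simp: good_def label_sorted_def)
  show "sorted_wrt (\<lambda>e x. edge_key x < edge_key e \<longrightarrow> endpoints x \<inter> endpoints e = {}) G"
    unfolding sorted_wrt_iff_nth_less
  proof (intro allI impI, rule ccontr)
    fix p q assume pq: "p < q" "q < length G" "edge_key (G ! q) < edge_key (G ! p)"
      "endpoints (G ! q) \<inter> endpoints (G ! p) \<noteq> {}"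
    then obtain v where v: "v \<in> endpoints (G ! q)" "v \<in> endpoints (G ! p)" by auto
    have mem: "G ! q \<in> set G" "G ! p \<in> set G" using pq by auto
    have sg: "G ! q \<in> signed_edges n" "G ! p \<in> signed_edges n"
      using st mem unfolding structured_def signed_graph_def by blast+
    have "incidence_sign (G ! q) v = incidence_sign (G ! p) v"
      using alternating_sign_coherent[OF st assms(2)] mem v unfolding sign_coherent_def by blast
    moreover have "\<not> clash (G ! q) (G ! p)"
      using st mem unfolding structured_def clash_def by blast
    moreover have "endpoints (G ! q) = endpoints (G ! p) \<longrightarrow> is_loop (G ! q)"
    proof
      assume eq: "endpoints (G ! q) = endpoints (G ! p)"
      have "G = take p G @ G ! p # drop (Suc p) G" using pq by (simp add: id_take_nth_drop)
      moreover have "G ! q \<in> set (drop (Suc p) G)"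
        using pq by (auto simp: in_set_conv_nth intro!: exI[of _ "q - Suc p"])
      then obtain m w where "drop (Suc p) G = m @ G ! q # w" by (meson split_list)
      ultimately have "structured n (take p G @ G ! p # m @ G ! q # w)" using st by simp
      then have "is_loop (G ! p)" using nonparallel eq by metis
      then show "is_loop (G ! q)" using eq by (cases "G ! p"; cases "G ! q") (auto simp: doubleton_eq_iff)
    qed
    ultimately have "prec (G ! q) (G ! p)"
      using alternating_key_prec[OF _ v sg] pq(3) by blast
    then show False using so pq unfolding sorted_wrt_iff_nth_less by blast
  qed
qed

section \<open>Words whose reductions end, and their weights\<close>

definition irreducible_word :: "letter list \<Rightarrow> bool" where
  "irreducible_word w \<longleftrightarrow> \<not> (\<exists>u a b v rs. comm_equiv w (u @ [a, b] @ v) \<and> reduction_rule a b rs)"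

text \<open>
  Records that the reductions of a word end; for the words of a polynomial that has a reduced form
  this is read off the given reduction, so termination need not be proved.
\<close>

inductive reduction_tree :: "letter list \<Rightarrow> bool" where
  leaf: "irreducible_word w \<Longrightarrow> reduction_tree w"
| node: "comm_equiv w (u @ [a, b] @ v) \<Longrightarrow> reduction_rule a b rs \<Longrightarrow>
    (\<And>r. r \<in> set rs \<Longrightarrow> reduction_tree (u @ r @ v)) \<Longrightarrow> reduction_tree w"

text \<open>The point is followed down the tree, at each node into a reduct whose cone contains it.
  The cones shrink on the way, and a leaf is alternating.\<close>

lemma reduction_tree_leaf_cone:
  assumes "reduction_tree w" "good n G" "w = graph_monomial G" "x \<in> edge_cone G"
  shows "\<exists>H. structured n H \<and> alternating n H \<and> x \<in> edge_cone H \<and> edge_cone H \<subseteq> edge_cone G"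
  using assms
proof (induction arbitrary: G rule: reduction_tree.induct)
  case (leaf w)
  then have st: "structured n G" by (simp add: good_def)
  moreover have "alternating n G"
    using irreducible_alternating[OF st] leaf by (auto simp: irreducible_word_def)
  ultimately show ?case using leaf by blast
next
  case (node w u a b v rs)
  obtain U e f V rs' where g: "good n (U @ [e, f] @ V)" "set (U @ [e, f] @ V) = set G"
    "edge_rule e f rs'" "rs = map (\<lambda>(e', f'). [edge_letter e', edge_letter f']) rs'"
    "u = map edge_letter U" "v = map edge_letter V"
    using good_reduction[OF node.prems(1)] node.hyps(1,2) node.prems(2) by metis
  have cone: "edge_cone (U @ [e, f] @ V) = edge_cone G" by (rule edge_cone_set_cong[OF g(2)])
  obtain e' f' where ef: "(e', f') \<in> set rs'" "x \<in> edge_cone (U @ [e', f'] @ V)"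
    using edge_rule_cone_cover[OF g(3), of x U V] node.prems(3) unfolding cone by blast
  have "[edge_letter e', edge_letter f'] \<in> set rs" using ef(1) unfolding g(4) by force
  moreover have "u @ [edge_letter e', edge_letter f'] @ v = graph_monomial (U @ [e', f'] @ V)"
    by (simp add: g graph_monomial_def)
  ultimately obtain H where "structured n H" "alternating n H" "x \<in> edge_cone H"
    "edge_cone H \<subseteq> edge_cone (U @ [e', f'] @ V)"
    using node.IH good_reduce[OF g(1,3) ef(1)] ef(2) by blast
  then show ?case using edge_rule_cone_subset[OF g(3) ef(1), of U V] unfolding cone by blast
qed

text \<open>The indicator is a function of words, so that \<open>total\<close> extends it linearly
  to polynomials; the graph of a word is unique. Words that belong to no good graph get the default
  value 0.\<close>

definition weight :: "nat \<Rightarrow> lgraph \<Rightarrow> letter list \<Rightarrow> rat" where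
  "weight n A w = (if \<exists>G. w = graph_monomial G \<and> good n G \<and> A \<in> admissible n G then 1 else 0)"

lemma weight_graph_monomial:
  "good n G \<Longrightarrow> weight n A (graph_monomial G) = (if A \<in> admissible n G then 1 else 0)"
  by (auto simp: weight_def)

lemma weight_reduction:
  assumes "good n G" "comm_equiv (graph_monomial G) (u @ [a, b] @ v)" "reduction_rule a b rs"
    and tree: "\<And>r. r \<in> set rs \<Longrightarrow> reduction_tree (u @ r @ v)"
  shows "weight n A (graph_monomial G) = (\<Sum>r\<leftarrow>rs. weight n A (u @ r @ v))"
proof -
  obtain U e f V rs' where g: "good n (U @ [e, f] @ V)" "set (U @ [e, f] @ V) = set G"
    "edge_rule e f rs'" "rs = map (\<lambda>(e', f'). [edge_letter e', edge_letter f']) rs'"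
    "u = map edge_letter U" "v = map edge_letter V"
    using good_reduction[OF assms(1-3)] by metis
  have cone: "edge_cone (U @ [e, f] @ V) = edge_cone G" by (rule edge_cone_set_cong[OF g(2)])
  \<comment> \<open>Reducts are indexed by their positions, because the separation is stated for
    positions \<open>a < b\<close>.\<close>
  define H where "H = (\<lambda>k. U @ [fst (rs' ! k), snd (rs' ! k)] @ V)"
  have nth: "(fst (rs' ! k), snd (rs' ! k)) \<in> set rs'" if "k < length rs'" for k using that by simp
  have len: "length rs = length rs'" by (simp add: g(4))
  have word: "u @ rs ! k @ v = graph_monomial (H k)" if "k < length rs'" for k
    using that by (simp add: g H_def graph_monomial_def split: prod.splits)
  have goodH: "good n (H k)" if "k < length rs'" for k
    unfolding H_def by (rule good_reduce[OF g(1,3) nth[OF that]])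
  have sub: "admissible n (H k) \<subseteq> admissible n G" if "k < length rs'" for k
    using edge_rule_cone_subset[OF g(3) nth[OF that], of U V] unfolding H_def cone by (rule admissible_mono)
  have disj: "k = l" if "k < length rs'" "l < length rs'" "A \<in> admissible n (H k)" "A \<in> admissible n (H l)" for k l
  proof -
    have *: False if "k < l" "l < length rs'" "A \<in> admissible n (H k)" "A \<in> admissible n (H l)" for k l
      using edge_rule_closure_disjoint[of n U e f V rs' k l "fst (rs' ! k)" "snd (rs' ! k)"
          "fst (rs' ! l)" "snd (rs' ! l)" A] g(1,3) that
      by (auto simp: good_def admissible_iff H_def)
    show ?thesis using *[of k l] *[of l k] that by (meson linorder_neqE_nat)
  qed
  \<comment> \<open>The covering puts only the point \<open>?x\<close> into the cone of a reduct. A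
    leaf below this reduct whose cone contains \<open>?x\<close> has the edges of \<open>A\<close>,
    so these lie in the cone of the reduct as well. This is where \<open>tree\<close>
    enters.\<close>
  have ex: "\<exists>k<length rs'. A \<in> admissible n (H k)" if A: "A \<in> admissible n G"
  proof -
    let ?x = "\<lambda>k. \<Sum>e\<in>set A. edge_vec e k"
    have A': "structured n A" "alternating n A" "set A \<subseteq> trans_closure n G" "sorted (map edge_key A)"
      using A by (auto simp: admissible_iff)
    from closure_sum_in_cone[OF A'(3)] obtain e' f' where ef: "(e', f') \<in> set rs'" "?x \<in> edge_cone (U @ [e', f'] @ V)"
      using edge_rule_cone_cover[OF g(3), of ?x U V] unfolding cone by blast
    then obtain k where k: "k < length rs'" "rs' ! k = (e', f')" by (auto simp: in_set_conv_nth)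
    have xk: "?x \<in> edge_cone (H k)" using ef k by (simp add: H_def)
    have "reduction_tree (graph_monomial (H k))"
      using tree[of "rs ! k"] word[OF k(1)] k(1) len by auto
    then obtain L where L: "structured n L" "alternating n L" "?x \<in> edge_cone L" "edge_cone L \<subseteq> edge_cone (H k)"
      using reduction_tree_leaf_cone[OF _ goodH[OF k(1)] refl xk] by blast
    have "set A = set L" by (rule alternating_sum_in_cone_unique[OF A'(1,2) L(1-3)])
    then have "set A \<subseteq> trans_closure n (H k)"
      using L(4) edge_vec_in_cone[of _ L] A'(1) by (auto simp: trans_closure_def structured_def signed_graph_def)
    then show ?thesis using A' k by (auto simp: admissible_iff)
  qed
  have "(\<Sum>r\<leftarrow>rs. weight n A (u @ r @ v)) = (\<Sum>k<length rs'. weight n A (u @ rs ! k @ v))"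
    by (simp add: sum_list_sum_nth len atLeast0LessThan)
  also have "\<dots> = (\<Sum>k<length rs'. if A \<in> admissible n (H k) then 1 else 0)"
    by (intro sum.cong refl) (simp add: word goodH weight_graph_monomial)
  also have "\<dots> = (if A \<in> admissible n G then 1 else 0)"
  proof (cases "A \<in> admissible n G")
    case True
    then obtain k where k: "k < length rs'" "A \<in> admissible n (H k)" using ex by blast
    have "(\<Sum>l<length rs'. if A \<in> admissible n (H l) then 1 else (0::rat)) = (\<Sum>l<length rs'. if l = k then 1 else 0)"
      using k disj by (intro sum.cong refl) auto
    then show ?thesis using True k(1) by simp
  next
    case False
    then have "A \<notin> admissible n (H k)" if "k < length rs'" for k using sub[OF that] by blast
    then show ?thesis using False by simp
  qed
  finally show ?thesis using weight_graph_monomial[OF assms(1)] by simp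
qed

section \<open>Linear functionals on polynomials and their invariance\<close>

definition total :: "(letter list \<Rightarrow> rat) \<Rightarrow> ncpoly \<Rightarrow> rat" where
  "total d p = (\<Sum>w\<in>Poly_Mapping.keys p. Poly_Mapping.lookup p w * d w)"

lemma total_superset:
  assumes "finite S" "Poly_Mapping.keys p \<subseteq> S"
  shows "total d p = (\<Sum>w\<in>S. Poly_Mapping.lookup p w * d w)"
  unfolding total_def using assms by (intro sum.mono_neutral_left) (auto simp: in_keys_iff)

lemma total_add: "total d (p + q) = total d p + total d q"
proof -
  let ?S = "Poly_Mapping.keys p \<union> Poly_Mapping.keys q"
  have "total d (p + q) = (\<Sum>w\<in>?S. Poly_Mapping.lookup (p + q) w * d w)"
    by (intro total_superset keys_add) simp
  then show ?thesis
    by (simp add: total_superset[of ?S p] total_superset[of ?S q] lookup_add algebra_simps sum.distrib)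
qed

lemma total_single: "total d (Poly_Mapping.single w c) = c * d w"
  by (simp add: total_def)

lemma total_diff: "total d (p - q) = total d p - total d q"
  using total_add[of d "p - q" q] by simp

lemma total_sum_list: "total d (\<Sum>r\<leftarrow>rs. f r) = (\<Sum>r\<leftarrow>rs. total d (f r))"
  by (induction rs) (simp_all add: total_add, simp add: total_def)

text \<open>Nonnegativity excludes cancellation: every word produced by a step really occurs in the
  new polynomial.\<close>

definition good_poly :: "nat \<Rightarrow> ncpoly \<Rightarrow> bool" where
  "good_poly n p \<longleftrightarrow> (\<forall>w. 0 \<le> Poly_Mapping.lookup p w) \<and>
     (\<forall>w\<in>Poly_Mapping.keys p. \<exists>G. w = graph_monomial G \<and> good n G)"

lemma lookup_sum_list:
  "Poly_Mapping.lookup (\<Sum>r\<leftarrow>rs. f r) x = (\<Sum>r\<leftarrow>rs. Poly_Mapping.lookup (f r) x)"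
  by (induction rs) (simp_all add: lookup_add)

lemma lookup_reduct:
  "Poly_Mapping.lookup (p - Poly_Mapping.single w (Poly_Mapping.lookup p w)
     + (\<Sum>r\<leftarrow>rs. Poly_Mapping.single (u @ r @ v) (c::rat))) x =
   (if x = w then 0 else Poly_Mapping.lookup p x) + (\<Sum>r\<leftarrow>rs. if u @ r @ v = x then c else 0)"
  by (simp add: lookup_add lookup_minus lookup_sum_list lookup_single when_def)

lemma sum_list_if_pos:
  fixes c :: rat
  assumes "0 < c" "r \<in> set rs" "P r"
  shows "0 < (\<Sum>r\<leftarrow>rs. if P r then c else 0)"
proof -
  have "0 \<le> (\<Sum>r\<leftarrow>xs. if P r then c else 0)" for xs
    using assms(1) by (intro sum_list_nonneg) auto
  then show ?thesis using assms(2) by (induction rs) (use assms(1,3) in \<open>auto simp: add_pos_nonneg add_nonneg_pos\<close>)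
qed

lemma reduction_step_invariants:
  assumes "reduction_step p q" "good_poly n p"
  shows "good_poly n q"
    and "(\<forall>w\<in>Poly_Mapping.keys q. reduction_tree w) \<Longrightarrow>
      (\<forall>w\<in>Poly_Mapping.keys p. reduction_tree w) \<and> total (weight n A) p = total (weight n A) q"
proof -
  from assms(1) obtain w u a b v rs where s: "w \<in> Poly_Mapping.keys p" "comm_equiv w (u @ [a, b] @ v)"
    "reduction_rule a b rs"
    and q: "q = p - Poly_Mapping.single w (Poly_Mapping.lookup p w)
          + (\<Sum>r\<leftarrow>rs. Poly_Mapping.single (u @ r @ v) (Poly_Mapping.lookup p w))"
    by (auto elim: reduction_step.cases)
  let ?c = "Poly_Mapping.lookup p w"
  have nonneg: "\<And>x. 0 \<le> Poly_Mapping.lookup p x"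
    and gd: "\<And>x. x \<in> Poly_Mapping.keys p \<Longrightarrow> \<exists>G. x = graph_monomial G \<and> good n G"
    using assms(2) by (auto simp: good_poly_def)
  have c: "0 < ?c" using s(1) nonneg[of w] by (simp add: in_keys_iff order_less_le)
  obtain G where G: "w = graph_monomial G" "good n G" using gd[OF s(1)] by blast
  obtain U e f V rs' where g: "good n (U @ [e, f] @ V)" "set (U @ [e, f] @ V) = set G"
    "edge_rule e f rs'" "rs = map (\<lambda>(e', f'). [edge_letter e', edge_letter f']) rs'"
    "u = map edge_letter U" "v = map edge_letter V"
    using good_reduction[OF G(2)] s(2,3) G(1) by metis
  have child: "\<exists>H. u @ r @ v = graph_monomial H \<and> good n H" if r: "r \<in> set rs" for r
  proof -
    obtain e' f' where "(e', f') \<in> set rs'" "r = [edge_letter e', edge_letter f']"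
      using r unfolding g(4) by auto
    then show ?thesis using good_reduce[OF g(1,3)]
      by (intro exI[of _ "U @ [e', f'] @ V"]) (auto simp: g graph_monomial_def)
  qed
  have lookup: "Poly_Mapping.lookup q x =
      (if x = w then 0 else Poly_Mapping.lookup p x) + (\<Sum>r\<leftarrow>rs. if u @ r @ v = x then ?c else 0)" for x
    unfolding q by (rule lookup_reduct)
  have sum_nonneg: "0 \<le> (\<Sum>r\<leftarrow>rs. if u @ r @ v = x then ?c else 0)" for x
    using c by (intro sum_list_nonneg) auto
  show "good_poly n q"
    unfolding good_poly_def
  proof (intro conjI allI ballI)
    fix x show "0 \<le> Poly_Mapping.lookup q x" using lookup[of x] nonneg[of x] sum_nonneg[of x] by simp
  next
    fix x assume x: "x \<in> Poly_Mapping.keys q"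
    show "\<exists>G. x = graph_monomial G \<and> good n G"
    proof (cases "x \<in> Poly_Mapping.keys p")
      case False
      then have "(\<Sum>r\<leftarrow>rs. if u @ r @ v = x then ?c else 0) \<noteq> 0"
        using x lookup[of x] by (auto simp: in_keys_iff split: if_splits)
      moreover have "(\<Sum>r\<leftarrow>xs. if u @ r @ v = x then ?c else 0) = 0"
        if "\<And>r. r \<in> set xs \<Longrightarrow> u @ r @ v \<noteq> x" for xs
        using that by (induction xs) auto
      ultimately obtain r where "r \<in> set rs" "u @ r @ v = x" by blast
      then show ?thesis using child by blast
    qed (rule gd)
  qed
  assume tree: "\<forall>w\<in>Poly_Mapping.keys q. reduction_tree w"
  \<comment> \<open>The word of a reduct has a positive coefficient in \<open>q\<close>, so the
    assumption on \<open>q\<close> applies to it.\<close>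
  have tc: "reduction_tree (u @ r @ v)" if "r \<in> set rs" for r
  proof -
    have "0 < (\<Sum>r'\<leftarrow>rs. if u @ r' @ v = u @ r @ v then ?c else 0)"
      by (rule sum_list_if_pos[OF c that]) simp
    then have "0 < Poly_Mapping.lookup q (u @ r @ v)" using lookup[of "u @ r @ v"] nonneg[of "u @ r @ v"] by simp
    then show ?thesis using tree by (simp add: in_keys_iff)
  qed
  have "reduction_tree x" if x: "x \<in> Poly_Mapping.keys p" for x
  proof (cases "x = w")
    case True
    then show ?thesis using reduction_tree.node[OF s(2,3)] tc by simp
  next
    case False
    then have "0 < Poly_Mapping.lookup q x"
      using x lookup[of x] nonneg[of x] sum_nonneg[of x] by (simp add: in_keys_iff order_less_le)
    then show ?thesis using tree by (simp add: in_keys_iff)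
  qed
  moreover have "total (weight n A) q = total (weight n A) p"
  proof -
    have "total (weight n A) q =
        total (weight n A) p - ?c * weight n A w + (\<Sum>r\<leftarrow>rs. ?c * weight n A (u @ r @ v))"
      unfolding q by (simp add: total_add total_diff total_single total_sum_list)
    also have "(\<Sum>r\<leftarrow>rs. ?c * weight n A (u @ r @ v)) = ?c * weight n A w"
      using weight_reduction[OF G(2) _ s(3) tc, of A] s(2) G(1) by (simp add: sum_list_const_mult)
    finally show ?thesis by simp
  qed
  ultimately show "(\<forall>w\<in>Poly_Mapping.keys p. reduction_tree w) \<and>
      total (weight n A) p = total (weight n A) q" by simp
qed

lemma reduction_steps_good_poly: "reduction_step\<^sup>*\<^sup>* p q \<Longrightarrow> good_poly n p \<Longrightarrow> good_poly n q"
  by (induction rule: rtranclp_induct) (auto intro: reduction_step_invariants)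

lemma irreducible_poly_words:
  assumes "\<nexists>Q. reduction_step P Q" "w \<in> Poly_Mapping.keys P"
  shows "irreducible_word w"
  unfolding irreducible_word_def using assms reduction_step.intros by blast

text \<open>The induction runs backwards from \<open>P\<close>, whose words are irreducible and thus
  leaves, since the trees for the words before a step are built from those after it.\<close>

lemma reduction_steps_total:
  assumes "reduction_step\<^sup>*\<^sup>* p P" "\<nexists>Q. reduction_step P Q" "good_poly n p"
  shows "(\<forall>w\<in>Poly_Mapping.keys p. reduction_tree w) \<and> total (weight n A) p = total (weight n A) P"
  using assms(1,3)
proof (induction rule: converse_rtranclp_induct)
  case base
  then show ?case using irreducible_poly_words[OF assms(2)] reduction_tree.leaf by blast
next
  case (step p q)
  then show ?case
    using reduction_step_invariants(1)[OF step(1,4)] reduction_step_invariants(2)[OF step(1,4), of A]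
    by simp
qed

section \<open>The commutation ideal\<close>

lemma comm_ideal_plus: "q \<in> comm_ideal \<Longrightarrow> p \<in> comm_ideal \<Longrightarrow> p + q \<in> comm_ideal"
proof (induction rule: comm_ideal.induct)
  case (comm_ideal_add q a b u v c)
  then show ?case using comm_ideal.comm_ideal_add[of "p + q" a b u v c] by (simp add: add.assoc)
qed simp

lemma comm_ideal_sum: "(\<And>a. a \<in> A \<Longrightarrow> f a \<in> comm_ideal) \<Longrightarrow> sum f A \<in> comm_ideal"
  by (induction A rule: infinite_finite_induct) (auto intro: comm_ideal_plus comm_ideal_zero)

text \<open>The differences of successive words in a sequence of commutations telescope.\<close>

lemma comm_equiv_ideal:
  "comm_equiv u w \<Longrightarrow> Poly_Mapping.single u c - Poly_Mapping.single w c \<in> comm_ideal"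
  unfolding comm_equiv_def
proof (induction rule: rtranclp_induct)
  case base
  show ?case by (simp add: comm_ideal_zero)
next
  case (step v w)
  from step(2) have "Poly_Mapping.single v c - Poly_Mapping.single w c \<in> comm_ideal"
    by (cases rule: comm_swap.cases) (use comm_ideal_add[OF comm_ideal_zero] in auto)
  from comm_ideal_plus[OF this step(3)] show ?case by simp
qed

lemma poly_mapping_sum_single:
  "(\<Sum>w\<in>Poly_Mapping.keys p. Poly_Mapping.single w (Poly_Mapping.lookup p w)) = p"
proof (rule poly_mapping_eqI)
  fix x
  show "Poly_Mapping.lookup (\<Sum>w\<in>Poly_Mapping.keys p. Poly_Mapping.single w (Poly_Mapping.lookup p w)) x
      = Poly_Mapping.lookup p x"
    by (simp add: lookup_sum lookup_single when_def in_keys_iff)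
qed

theorem theorem26:
  fixes n :: nat and T :: lgraph and P :: ncpoly
  assumes "signed_graph n T"
    and "well_structured n T"
    and "well_labeled T"
    and "reduced_form (graph_monomial T) P"
  shows "eq_up_to_commutations P
    (\<Sum>G | spanning_graph_of_closure n T G \<and> alternating n G \<and> well_structured n G
             \<and> lexicographic_labels G.
       Poly_Mapping.single (graph_monomial G) 1)"
proof -
  let ?K = "Poly_Mapping.keys P" and ?c = "Poly_Mapping.lookup P"
  have T: "good n T"
    using assms(1-3) by (simp add: good_def well_structured_iff well_labeled_iff)
  have P: "reduction_step\<^sup>*\<^sup>* (Poly_Mapping.single (graph_monomial T) 1) P" "\<nexists>Q. reduction_step P Q"
    using assms(4) by (auto simp: reduced_form_def)
  have gp: "good_poly n (Poly_Mapping.single (graph_monomial T) 1)"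
    using T by (auto simp: good_poly_def lookup_single when_def)
  have total: "total (weight n A) P = (if A \<in> admissible n T then 1 else 0)" for A
    using reduction_steps_total[OF P gp, of A] weight_graph_monomial[OF T]
    by (simp add: total_single)
  have "\<forall>w\<in>?K. \<exists>G. w = graph_monomial G \<and> good n G"
    using reduction_steps_good_poly[OF P(1) gp] by (simp add: good_poly_def)
  then obtain g where g: "\<And>w. w \<in> ?K \<Longrightarrow> w = graph_monomial (g w)" "\<And>w. w \<in> ?K \<Longrightarrow> good n (g w)"
    by metis
  have alt: "alternating n (g w)" if w: "w \<in> ?K" for w
    using irreducible_alternating[of n "g w"] irreducible_poly_words[OF P(2) w] g[OF w]
    unfolding irreducible_word_def good_def by metis
  \<comment> \<open>The terms of \<open>P\<close> are collected at the lexicographic relabelings of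
    their graphs.\<close>
  define s where "s = (\<lambda>w. sort_key edge_key (g w))"
  have weight: "weight n A w = (if s w = A then 1 else 0)" if w: "w \<in> ?K" for A w
  proof -
    have "admissible n (g w) = {s w}"
      unfolding s_def using g(2)[OF w] alt[OF w] by (intro admissible_alternating) (auto simp: good_def)
    then show ?thesis using weight_graph_monomial[OF g(2)[OF w], of A] g(1)[OF w] by auto
  qed
  have "(\<Sum>w\<in>?K. Poly_Mapping.single w (?c w)) - (\<Sum>w\<in>?K. Poly_Mapping.single (graph_monomial (s w)) (?c w))
      \<in> comm_ideal"
    unfolding sum_subtractf[symmetric]
  proof (rule comm_ideal_sum)
    fix w assume w: "w \<in> ?K"
    have "comm_equiv w (graph_monomial (s w))"
      using comm_equiv_sym[OF good_alternating_sort[OF g(2)[OF w] alt[OF w]]] g(1)[OF w] by (simp add: s_def)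
    then show "Poly_Mapping.single w (?c w) - Poly_Mapping.single (graph_monomial (s w)) (?c w) \<in> comm_ideal"
      by (rule comm_equiv_ideal)
  qed
  moreover have "(\<Sum>w\<in>?K. Poly_Mapping.single (graph_monomial (s w)) (?c w)) =
      (\<Sum>G\<in>admissible n T. Poly_Mapping.single (graph_monomial G) 1)"
  proof (rule poly_mapping_eqI)
    fix x
    have lhs: "Poly_Mapping.lookup (\<Sum>w\<in>?K. Poly_Mapping.single (graph_monomial (s w)) (?c w)) x =
        (\<Sum>w\<in>?K. if graph_monomial (s w) = x then ?c w else 0)"
      by (simp add: lookup_sum lookup_single when_def)
    have rhs: "Poly_Mapping.lookup (\<Sum>G\<in>admissible n T. Poly_Mapping.single (graph_monomial G) (1::rat)) x =
        (\<Sum>G\<in>admissible n T. if graph_monomial G = x then 1 else 0)"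
      by (simp add: lookup_sum lookup_single when_def)
    show "Poly_Mapping.lookup (\<Sum>w\<in>?K. Poly_Mapping.single (graph_monomial (s w)) (?c w)) x =
        Poly_Mapping.lookup (\<Sum>G\<in>admissible n T. Poly_Mapping.single (graph_monomial G) 1) x"
    proof (cases "x \<in> range graph_monomial")
      case True
      then obtain A where x: "x = graph_monomial A" by auto
      \<comment> \<open>On the words of \<open>P\<close> the weight is the indicator of
        \<open>s w = A\<close>, so the collected coefficient is \<open>total (weight n A) P\<close>,
        known from the single word of \<open>T\<close> by invariance.\<close>
      have "(\<Sum>w\<in>?K. if graph_monomial (s w) = x then ?c w else 0) = total (weight n A) P"
        unfolding total_def x by (intro sum.cong refl) (simp add: weight)
      then show ?thesis unfolding lhs rhs total by (simp add: x finite_admissible)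
    next
      case False
      then have "graph_monomial G \<noteq> x" for G by auto
      then show ?thesis unfolding lhs rhs by simp
    qed
  qed
  ultimately show ?thesis
    unfolding eq_up_to_commutations_def poly_mapping_sum_single admissible_def by simp
qed

end
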